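(* The function $$w(x):=\inf_{\tau\in\mathcal{T}_0} \mathbb{E}_x\left[e^{\sum_{i=0}^{\tau-1} g(X_i)+G(X_\tau)}\right],\quad x\in E,$$ is continuous and bounded. Moreover, $\underline w(x)= w(x)=\overline w(x)$ for every $x\in E$, and the optimal stopping time for $w$ (i.e. a stopping time attaining the infimum, for every $x\in E$) is given by $$\hat \tau:=\inf\left\{i\geq 0: w(X_i)=e^{G(X_i)}\right\}.$$
   Context: Setting: $(\Omega,\mathcal{F},(\mathcal{F}_t)_{t\geq 0},\mathbb{P})$ is a filtered probability space satisfying the usual conditions, with $\mathcal{F}_0$ trivial. $X=(X_t)_{t\ge 0}$ is a time-homogeneous standard Markov process (right-continuous, strong Markov, quasi-left-continuous) with values in a locally compact separable metric space $(E,\rho)$ with its Borel $\sigma$-field; $\mathbb{P}_x,\mathbb{E}_x$ denote probability and expectation when $X_0=x$. The transition semigroup $P_tf(x)=\mathbb{E}_x[f(X_t)]$ is $C_0$-Feller: $P_tC_0(E)\subset C_0(E)$ for each $t\ge 0$, where $C_0(E)$ is the set of continuous bounded functions vanishing at infinity. This implies the Feller property $P_tC(E)\subset C(E)$, where $C(E)$ is the set of continuous bounded real functions. The functions $g,G:E\to\mathbb{R}$ are continuous, bounded and non-negative, and $g(\cdot)\geq c$ for some constant $c>0$. Discrete time: one considers the process $(X_n)_{n\in\mathbb{N}}$ at integer times with filtration $(\mathcal{F}_n)_{n\in\mathbb{N}}$, $\mathbb{N}=\{0,1,2,\dots\}$. $\mathcal{T}_0$ is the family of almost surely finite stopping times with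 values in $\{0,1,2,\dots\}$. Conventions: $\sum_{i=0}^{-1}(\cdot)=0$; for a process $(Z_n)$ and $\tau\in\mathcal{T}_0$, $\mathbb{E}_x[Z_\tau]:=\liminf_{n\to\infty}\mathbb{E}_x[Z_{\tau\wedge n}]$. For $n\in\mathbb{N}$ and $x\in E$, with infima over $\tau\in\mathcal{T}_0$ with $\tau\le n$, $$\underline w_n(x):=\inf_{\tau\leq n} \mathbb{E}_x\left[e^{\sum_{i=0}^{\tau-1} g(X_i)+1_{\{\tau<n\}}G(X_\tau) }\right],\qquad \overline w_n(x):=\inf_{\tau\leq n} \mathbb{E}_x\left[e^{\sum_{i=0}^{\tau-1} g(X_i)+G(X_\tau)}\right].$$ For each $x$, $(\underline w_n(x))$ is non-decreasing and $(\overline w_n(x))$ is non-increasing, and one sets $\underline w(x):=\lim_{n\to\infty}\underline w_{n}(x)$ and $\overline w(x):=\lim_{n\to\infty}\overline w_{n}(x)$. *)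

theory Defs
  imports "HOL-Probability.Probability"
begin

section \<open>Markov processes\<close>

text \<open>
  The time set is \<open>[0,\<infinity>]\<close>, that is, type \<^typ>\<open>ennreal\<close>, so that the library notions
  \<^const>\<open>stopping_time\<close> and \<open>filtration.pre_sigma\<close> cover stopping times with value \<open>\<infinity>\<close>.
  \<open>F \<infinity>\<close> may be any \<open>\<sigma>\<close>-algebra containing all \<open>F t\<close>, and the value of a process at time
  \<open>\<infinity>\<close> is unconstrained and never used.
\<close>

locale usual_filtered_space = prob_space M + filtration "space M" F
  for M :: "'w measure" and F :: "ennreal \<Rightarrow> 'w measure" +
  assumes sets_F_subset: "\<And>t. sets (F t) \<subseteq> sets M"
    and complete: "\<And>A N. N \<in> null_sets M \<Longrightarrow> A \<subseteq> N \<Longrightarrow> A \<in> sets (F 0)"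
    and right_continuous: "\<And>t. t < \<infinity> \<Longrightarrow> sets (F t) = (\<Inter>s\<in>{t<..}. sets (F s))"

definition transition ::
  "('e \<Rightarrow> 'w measure) \<Rightarrow> (ennreal \<Rightarrow> 'w \<Rightarrow> 'e) \<Rightarrow> ennreal \<Rightarrow> ('e \<Rightarrow> real) \<Rightarrow> 'e \<Rightarrow> real" where
  "transition P X t f x = (\<integral>\<omega>. f (X t \<omega>) \<partial>P x)"

text \<open>
  For every starting point \<open>x\<close>, the space \<open>\<Omega>\<close> with the measure \<open>P x\<close> and the filtration
  \<open>F x\<close> satisfies the usual conditions. The \<open>\<sigma>\<close>-algebras may depend on \<open>x\<close> because completeness
  refers to the null sets of \<open>P x\<close>: the laws for different starting points are mutually singular,
  and one filtration containing the null sets of each of them would contain every subset of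
  \<open>{X 0 = y}\<close> for each \<open>y\<close>.
\<close>

locale standard_markov_process =
  fixes \<Omega> :: "'w set"
    and P :: "'e::metric_space \<Rightarrow> 'w measure"
    and F :: "'e \<Rightarrow> ennreal \<Rightarrow> 'w measure"
    and X :: "ennreal \<Rightarrow> 'w \<Rightarrow> 'e"
  assumes space_P: "\<And>x. space (P x) = \<Omega>"
    and usual: "\<And>x. usual_filtered_space (P x) (F x)"
    and F_0_trivial: "\<And>x A. A \<in> sets (F x 0) \<Longrightarrow> measure (P x) A \<in> {0, 1}"
    and adapted: "\<And>x t. t < \<infinity> \<Longrightarrow> X t \<in> measurable (F x t) borel"
    and start: "\<And>x. AE \<omega> in P x. X 0 \<omega> = x"
    and kernel: "\<And>t B. t < \<infinity> \<Longrightarrow> B \<in> sets borel \<Longrightarrow>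
      (\<lambda>x. measure (P x) {\<omega> \<in> \<Omega>. X t \<omega> \<in> B}) \<in> borel_measurable borel"
    and right_continuous_paths:
      "\<And>x. AE \<omega> in P x. \<forall>t<\<infinity>. ((\<lambda>s. X s \<omega>) \<longlongrightarrow> X t \<omega>) (at_right t)"
    and strong_markov: "\<And>x T t f. stopping_time (F x) T \<Longrightarrow> t < \<infinity> \<Longrightarrow>
      f \<in> borel_measurable borel \<Longrightarrow> bounded (range f) \<Longrightarrow>
      AE \<omega> in P x.
        real_cond_exp (P x) (filtration.pre_sigma \<Omega> (F x) T)
          (\<lambda>\<omega>. indicator {\<omega>. T \<omega> < \<infinity>} \<omega> * f (X (T \<omega> + t) \<omega>)) \<omega>
        = indicator {\<omega>. T \<omega> < \<infinity>} \<omega> * transition P X t f (X (T \<omega>) \<omega>)"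
    and quasi_left_continuous: "\<And>x S T. (\<And>n::nat. stopping_time (F x) (S n)) \<Longrightarrow>
      (\<And>\<omega>. \<omega> \<in> \<Omega> \<Longrightarrow> incseq (\<lambda>n. S n \<omega>)) \<Longrightarrow>
      (\<And>\<omega>. \<omega> \<in> \<Omega> \<Longrightarrow> T \<omega> = (SUP n. S n \<omega>)) \<Longrightarrow>
      AE \<omega> in P x. T \<omega> < \<infinity> \<longrightarrow> (\<lambda>n. X (S n \<omega>) \<omega>) \<longlonglongrightarrow> X (T \<omega>) \<omega>"

text \<open>Vanishing at infinity is meant in the sense of the one-point compactification.\<close>

definition C0 :: "('e::topological_space \<Rightarrow> real) set" where
  "C0 = {f. continuous_on UNIV f \<and> bounded (range f) \<and>
            (\<forall>\<epsilon>>0. \<exists>K. compact K \<and> (\<forall>x. x \<notin> K \<longrightarrow> \<bar>f x\<bar> < \<epsilon>))}"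

definition C0_Feller ::
  "('e::topological_space \<Rightarrow> 'w measure) \<Rightarrow> (ennreal \<Rightarrow> 'w \<Rightarrow> 'e) \<Rightarrow> bool" where
  "C0_Feller P X \<longleftrightarrow> (\<forall>t<\<infinity>. \<forall>f\<in>C0. transition P X t f \<in> C0)"

section \<open>Optimal stopping at integer times\<close>

text \<open>Stopping times for the filtration \<open>(F x n)\<close>, \<open>n = 0, 1, 2, \<dots>\<close>, that are almost surely
  finite under \<open>P x\<close>.\<close>

definition finite_stopping_times ::
  "('e \<Rightarrow> 'w measure) \<Rightarrow> ('e \<Rightarrow> ennreal \<Rightarrow> 'w measure) \<Rightarrow> 'e \<Rightarrow> ('w \<Rightarrow> enat) set" where
  "finite_stopping_times P F x =
     {\<tau>. stopping_time (\<lambda>i. F x (ennreal_of_enat i)) \<tau> \<and> (AE \<omega> in P x. \<tau> \<omega> < \<infinity>)}"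

text \<open>The expectation of \<open>Z \<tau>\<close> is by convention the lower limit of the expectations of
  \<open>Z (min \<tau> m)\<close>.\<close>

definition stopped_expectation ::
  "'w measure \<Rightarrow> (nat \<Rightarrow> 'w \<Rightarrow> real) \<Rightarrow> ('w \<Rightarrow> enat) \<Rightarrow> ennreal" where
  "stopped_expectation M Z \<tau> =
     liminf (\<lambda>m. \<integral>\<^sup>+\<omega>. ennreal (Z (the_enat (min (\<tau> \<omega>) (enat m))) \<omega>) \<partial>M)"

definition cost ::
  "(ennreal \<Rightarrow> 'w \<Rightarrow> 'e) \<Rightarrow> ('e \<Rightarrow> real) \<Rightarrow> ('e \<Rightarrow> real) \<Rightarrow> nat \<Rightarrow> 'w \<Rightarrow> real" where
  "cost X g G k \<omega> = exp ((\<Sum>i<k. g (X (of_nat i) \<omega>)) + G (X (of_nat k) \<omega>))"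

definition lower_cost ::
  "(ennreal \<Rightarrow> 'w \<Rightarrow> 'e) \<Rightarrow> ('e \<Rightarrow> real) \<Rightarrow> ('e \<Rightarrow> real) \<Rightarrow> nat \<Rightarrow> nat \<Rightarrow> 'w \<Rightarrow> real" where
  "lower_cost X g G n k \<omega> =
     exp ((\<Sum>i<k. g (X (of_nat i) \<omega>)) + of_bool (k < n) * G (X (of_nat k) \<omega>))"

definition stop_value ::
  "('e \<Rightarrow> 'w measure) \<Rightarrow> ('e \<Rightarrow> ennreal \<Rightarrow> 'w measure) \<Rightarrow> (ennreal \<Rightarrow> 'w \<Rightarrow> 'e) \<Rightarrow>
   ('e \<Rightarrow> real) \<Rightarrow> ('e \<Rightarrow> real) \<Rightarrow> 'e \<Rightarrow> ennreal" where
  "stop_value P F X g G x =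
     (INF \<tau>\<in>finite_stopping_times P F x. stopped_expectation (P x) (cost X g G) \<tau>)"

definition lower_value_n ::
  "('e \<Rightarrow> 'w measure) \<Rightarrow> ('e \<Rightarrow> ennreal \<Rightarrow> 'w measure) \<Rightarrow> (ennreal \<Rightarrow> 'w \<Rightarrow> 'e) \<Rightarrow>
   ('e \<Rightarrow> real) \<Rightarrow> ('e \<Rightarrow> real) \<Rightarrow> nat \<Rightarrow> 'e \<Rightarrow> ennreal" where
  "lower_value_n P F X g G n x =
     (INF \<tau>\<in>{\<tau> \<in> finite_stopping_times P F x. \<forall>\<omega>\<in>space (P x). \<tau> \<omega> \<le> enat n}.
        stopped_expectation (P x) (lower_cost X g G n) \<tau>)"

definition upper_value_n ::
  "('e \<Rightarrow> 'w measure) \<Rightarrow> ('e \<Rightarrow> ennreal \<Rightarrow> 'w measure) \<Rightarrow> (ennreal \<Rightarrow> 'w \<Rightarrow> 'e) \<Rightarrow>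
   ('e \<Rightarrow> real) \<Rightarrow> ('e \<Rightarrow> real) \<Rightarrow> nat \<Rightarrow> 'e \<Rightarrow> ennreal" where
  "upper_value_n P F X g G n x =
     (INF \<tau>\<in>{\<tau> \<in> finite_stopping_times P F x. \<forall>\<omega>\<in>space (P x). \<tau> \<omega> \<le> enat n}.
        stopped_expectation (P x) (cost X g G) \<tau>)"

text \<open>Both limits exist by monotonicity, see \<open>lower_value_n_tendsto\<close> and \<open>upper_value_n_tendsto\<close> below.\<close>

definition lower_value ::
  "('e \<Rightarrow> 'w measure) \<Rightarrow> ('e \<Rightarrow> ennreal \<Rightarrow> 'w measure) \<Rightarrow> (ennreal \<Rightarrow> 'w \<Rightarrow> 'e) \<Rightarrow>
   ('e \<Rightarrow> real) \<Rightarrow> ('e \<Rightarrow> real) \<Rightarrow> 'e \<Rightarrow> ennreal" where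
  "lower_value P F X g G x = lim (\<lambda>n. lower_value_n P F X g G n x)"

definition upper_value ::
  "('e \<Rightarrow> 'w measure) \<Rightarrow> ('e \<Rightarrow> ennreal \<Rightarrow> 'w measure) \<Rightarrow> (ennreal \<Rightarrow> 'w \<Rightarrow> 'e) \<Rightarrow>
   ('e \<Rightarrow> real) \<Rightarrow> ('e \<Rightarrow> real) \<Rightarrow> 'e \<Rightarrow> ennreal" where
  "upper_value P F X g G x = lim (\<lambda>n. upper_value_n P F X g G n x)"

text \<open>In \<^typ>\<open>enat\<close>, the infimum of the empty set is \<open>\<infinity>\<close>.\<close>

definition tau_hat ::
  "('e \<Rightarrow> 'w measure) \<Rightarrow> ('e \<Rightarrow> ennreal \<Rightarrow> 'w measure) \<Rightarrow> (ennreal \<Rightarrow> 'w \<Rightarrow> 'e) \<Rightarrow>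
   ('e \<Rightarrow> real) \<Rightarrow> ('e \<Rightarrow> real) \<Rightarrow> 'w \<Rightarrow> enat" where
  "tau_hat P F X g G \<omega> =
     Inf {enat i | i. stop_value P F X g G (X (of_nat i) \<omega>) = ennreal (exp (G (X (of_nat i) \<omega>)))}"

lemma upper_value_n_decseq: "decseq (\<lambda>n. upper_value_n P F X g G n x)"
  unfolding decseq_Suc_iff upper_value_n_def
proof (intro allI INF_superset_mono)
  fix n
  have "enat n \<le> enat (Suc n)"
    by simp
  then show "{\<tau> \<in> finite_stopping_times P F x. \<forall>\<omega>\<in>space (P x). \<tau> \<omega> \<le> enat n}
    \<subseteq> {\<tau> \<in> finite_stopping_times P F x. \<forall>\<omega>\<in>space (P x). \<tau> \<omega> \<le> enat (Suc n)}"
    by (blast intro: order_trans)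
qed simp

lemma upper_value_n_tendsto:
  "(\<lambda>n. upper_value_n P F X g G n x) \<longlonglongrightarrow> upper_value P F X g G x"
  unfolding upper_value_def convergent_LIMSEQ_iff[symmetric]
  by (rule convergentI[OF LIMSEQ_INF[OF upper_value_n_decseq]])

lemma lower_cost_mono:
  assumes "\<And>y. 0 \<le> g y" "\<And>y. 0 \<le> G y" "k \<le> Suc n"
  shows "lower_cost X g G n (min k n) \<omega> \<le> lower_cost X g G (Suc n) k \<omega>"
proof (cases "k \<le> n")
  case True
  then show ?thesis
    using assms by (auto simp: lower_cost_def of_bool_def)
next
  case False
  then have "k = Suc n"
    using assms(3) by simp
  then show ?thesis
    using assms by (simp add: lower_cost_def)
qed

lemma lower_value_n_incseq:
  assumes g: "\<And>y. 0 \<le> g y" and G: "\<And>y. 0 \<le> G y"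
  shows "incseq (\<lambda>n. lower_value_n P F X g G n x)"
  unfolding incseq_Suc_iff lower_value_n_def
proof (intro allI INF_mono)
  fix n \<tau>
  assume "\<tau> \<in> {\<tau> \<in> finite_stopping_times P F x. \<forall>\<omega>\<in>space (P x). \<tau> \<omega> \<le> enat (Suc n)}"
  then have \<tau>: "stopping_time (\<lambda>i. F x (ennreal_of_enat i)) \<tau>"
    and fin: "AE \<omega> in P x. \<tau> \<omega> < \<infinity>" and le: "\<And>\<omega>. \<omega> \<in> space (P x) \<Longrightarrow> \<tau> \<omega> \<le> enat (Suc n)"
    by (auto simp: finite_stopping_times_def)
  let ?\<sigma> = "\<lambda>\<omega>. min (\<tau> \<omega>) (enat n)"
  have "?\<sigma> \<in> {\<tau> \<in> finite_stopping_times P F x. \<forall>\<omega>\<in>space (P x). \<tau> \<omega> \<le> enat n}"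
    using stopping_time_min[OF \<tau> stopping_time_const[of _ "enat n"]] fin
    by (auto simp: finite_stopping_times_def min_less_iff_disj simp del: not_infinity_eq)
  moreover have "stopped_expectation (P x) (lower_cost X g G n) ?\<sigma>
      \<le> stopped_expectation (P x) (lower_cost X g G (Suc n)) \<tau>"
    unfolding stopped_expectation_def
  proof (intro Liminf_mono always_eventually allI nn_integral_mono ennreal_leI)
    fix m \<omega> assume "\<omega> \<in> space (P x)"
    then obtain j where j: "\<tau> \<omega> = enat j" "j \<le> Suc n"
      using le[of \<omega>] by (cases "\<tau> \<omega>") auto
    then show "lower_cost X g G n (the_enat (min (?\<sigma> \<omega>) (enat m))) \<omega>
        \<le> lower_cost X g G (Suc n) (the_enat (min (\<tau> \<omega>) (enat m))) \<omega>"
      using lower_cost_mono[where k = "min j m" and n = n and X = X and \<omega> = \<omega>, OF g G]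
      by (simp add: min.commute min.left_commute)
  qed
  ultimately show "\<exists>\<sigma>\<in>{\<tau> \<in> finite_stopping_times P F x. \<forall>\<omega>\<in>space (P x). \<tau> \<omega> \<le> enat n}.
      stopped_expectation (P x) (lower_cost X g G n) \<sigma>
      \<le> stopped_expectation (P x) (lower_cost X g G (Suc n)) \<tau>"
    by blast
qed

lemma lower_value_n_tendsto:
  assumes "\<And>y. 0 \<le> g y" "\<And>y. 0 \<le> G y"
  shows "(\<lambda>n. lower_value_n P F X g G n x) \<longlonglongrightarrow> lower_value P F X g G x"
  unfolding lower_value_def convergent_LIMSEQ_iff[symmetric]
  by (rule convergentI[OF LIMSEQ_SUP[OF lower_value_n_incseq[OF assms]]])

end

theory Submission
  imports Defs
begin

text \<open>
  Let \<open>T f = min (exp G) (exp g * P\<^sub>1 f)\<close> and let \<open>w\<close> be the increasing limit of the iterates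
  \<open>T\<^sup>n 1\<close>. Since \<open>T\<close> is monotone and concave and \<open>T a \<ge> 1 > a\<close> for the constant \<open>a = exp (- c)\<close>,
  induction gives \<open>T\<^sup>n 1 \<ge> (1 - \<kappa>\<^sup>n) w + \<kappa>\<^sup>n a\<close> for some \<open>\<kappa> < 1\<close>. So the convergence is uniform, and
  \<open>w\<close> inherits continuity from the iterates by the Feller property.

  The Markov property gives \<open>T\<^sup>n 1\<close> as a lower bound for the cost of every stopping time. Conversely,
  where \<open>w < exp G\<close> one has \<open>exp g * P\<^sub>1 (w - a) = w - exp g * a \<le> \<kappa> (w - a)\<close>. Hence the
  contribution to the expected cost of not having hit \<open>{w = exp G}\<close> by time \<open>n\<close> decays like \<open>\<kappa>\<^sup>n\<close>,
  although the running cost may grow exponentially. This makes the hitting time finite, and its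
  truncations have expected cost converging to \<open>w\<close>.
\<close>

section \<open>The Feller property on bounded continuous functions\<close>

text \<open>Multiplication by \<open>\<phi> n\<close> brings bounded continuous functions into
  \<open>C0\<close>, where \<open>C0_Feller\<close> applies. Local compactness and separability give
  a countable cover by balls whose closed balls are compact; \<open>\<phi> n\<close> is built from
  tents over the first \<open>n\<close> of them.\<close>

lemma exists_C0_approx_unit:
  assumes lc: "locally_compact_space (euclidean :: 'e::metric_space topology)"
    and sep: "separable_space (euclidean :: 'e topology)"
  shows "\<exists>\<phi> :: nat \<Rightarrow> 'e \<Rightarrow> real.
    (\<forall>n f. continuous_on UNIV f \<longrightarrow> bounded (range f) \<longrightarrow> (\<lambda>y. \<phi> n y * f y) \<in> C0) \<and>
    (\<forall>n y. 0 \<le> \<phi> n y \<and> \<phi> n y \<le> 1) \<and> (\<forall>y. (\<lambda>n. \<phi> n y) \<longlonglongrightarrow> 1)"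
proof -
  obtain D :: "'e set" where D: "countable D" "closure D = UNIV"
    using sep by (auto simp: separable_space_def)
  define I where "I = {(q, k::nat). q \<in> D \<and> compact (cball q (1 / Suc k))}"
  have cI: "countable I"
    by (rule countable_subset[of _ "D \<times> UNIV"]) (auto simp: I_def D)
  have cover: "\<exists>(q, k)\<in>I. y \<in> ball q (1 / Suc k)" for y
  proof -
    obtain U K where UK: "open U" "compact K" "y \<in> U" "U \<subseteq> K"
      using lc unfolding locally_compact_space_def by (auto simp del: ex_simps dest!: spec[of _ y])
    then obtain r where r: "0 < r" "cball y r \<subseteq> U"
      by (meson open_contains_cball)
    obtain k :: nat where k: "1 / Suc k < r / 2"
      using nat_approx_posE[of "r / 2"] r by auto
    have "y \<in> closure D"
      using D by auto
    then obtain q where q: "q \<in> D" "dist q y < 1 / Suc k"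
      unfolding closure_approachable by (auto dest!: spec[of _ "1 / Suc k"])
    \<comment> \<open>Points of this ball are within \<open>2 / Suc k < r\<close> of
      \<open>y\<close>.\<close>
    have "cball q (1 / Suc k) \<subseteq> cball y r"
    proof
      fix z assume "z \<in> cball q (1 / Suc k)"
      then show "z \<in> cball y r"
        using q k dist_triangle[of y z q] by (simp add: dist_commute)
    qed
    then have "cball q (1 / Suc k) \<subseteq> K"
      using r UK by blast
    then have "compact (cball q (1 / Suc k))"
      using compact_Int_closed[OF UK(2), of "cball q (1 / Suc k)"] by (simp add: inf.absorb2)
    then have "(q, k) \<in> I"
      using q by (simp add: I_def)
    then show ?thesis
      using q by (intro bexI[of _ "(q, k)"]) auto
  qed
  then have "I \<noteq> {}"
    by blast
  define e where "e = from_nat_into I"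
  have e: "range e = I"
    unfolding e_def by (rule range_from_nat_into[OF \<open>I \<noteq> {}\<close> cI])
  \<comment> \<open>The tent \<open>h i\<close> is positive exactly on the open ball with index
    \<open>i\<close>. In \<open>\<phi>\<close>, the factor \<open>n\<close> lets the truncated value
    reach 1 at each point for all large \<open>n\<close>, however small the sum of tents is
    there.\<close>
  define h where "h i y = max 0 (1 / Suc (snd (e i)) - dist (fst (e i)) y)" for i y
  define \<phi> where "\<phi> n y = min 1 (real n * (\<Sum>i<n. h i y))" for n y
  have h0: "0 \<le> h i y" for i y
    by (simp add: h_def)
  have cont: "continuous_on UNIV (\<phi> n)" for n
    unfolding \<phi>_def h_def by (intro continuous_intros)
  have nonneg: "0 \<le> \<phi> n y" for n y
    by (simp add: \<phi>_def h0 sum_nonneg)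
  have le1: "\<phi> n y \<le> 1" for n y
    by (simp add: \<phi>_def)
  have mult: "(\<lambda>y. \<phi> n y * f y) \<in> C0" if f: "continuous_on UNIV f" "bounded (range f)" for n f
  proof -
    obtain B where B: "\<And>y. \<bar>f y\<bar> \<le> B"
      using f(2) by (auto simp: bounded_iff)
    have bd: "bounded (range (\<lambda>y. \<phi> n y * f y))"
    proof (rule boundedI)
      fix z assume "z \<in> range (\<lambda>y. \<phi> n y * f y)"
      then obtain y where "z = \<phi> n y * f y" by auto
      then show "norm z \<le> B"
        using mult_mono[OF le1[of n y] B[of y]] nonneg[of n y] by (simp add: abs_mult)
    qed
    \<comment> \<open>All tents entering \<open>\<phi> n\<close> vanish outside this compact set, so
      one \<open>K\<close> serves every \<open>\<epsilon>\<close>.\<close>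
    let ?K = "\<Union>i<n. cball (fst (e i)) (1 / Suc (snd (e i)))"
    have "e i \<in> I" for i
      using e by auto
    then have "compact ?K"
      by (intro compact_UN) (auto simp: I_def case_prod_beta)
    moreover have "\<phi> n y = 0" if "y \<notin> ?K" for y
    proof -
      have "h i y = 0" if "i < n" for i
        using \<open>y \<notin> ?K\<close> that by (auto simp: h_def not_le)
      then show ?thesis
        by (simp add: \<phi>_def)
    qed
    ultimately have "\<forall>\<epsilon>>0. \<exists>K. compact K \<and> (\<forall>y. y \<notin> K \<longrightarrow> \<bar>\<phi> n y * f y\<bar> < \<epsilon>)"
      by (intro allI impI exI[of _ ?K]) simp
    then show ?thesis
      using bd continuous_on_mult[OF cont f(1)] by (simp add: C0_def)
  qed
  have lim: "(\<lambda>n. \<phi> n y) \<longlonglongrightarrow> 1" for y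
  proof -
    obtain q k where qk: "(q, k) \<in> I" "y \<in> ball q (1 / Suc k)"
      using cover[of y] by auto
    then obtain i where i: "e i = (q, k)"
      using e by (metis imageE)
    have pos: "0 < h i y"
      using qk(2) by (simp add: h_def i)
    obtain N :: nat where N: "1 / h i y < N"
      using reals_Archimedean2 by blast
    have "\<phi> n y = 1" if n: "n \<ge> max N (Suc i)" for n
    proof -
      have "h i y \<le> (\<Sum>i<n. h i y)"
        using n by (intro member_le_sum) (auto simp: h0)
      moreover have "1 \<le> real N * h i y"
        using N pos by (simp add: field_simps)
      ultimately have "1 \<le> real n * (\<Sum>i<n. h i y)"
        using n mult_mono[of "real N" "real n" "h i y" "\<Sum>i<n. h i y"] pos by auto
      then show ?thesis
        by (simp add: \<phi>_def)
    qed
    then show ?thesis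
      by (intro tendsto_eventually eventually_sequentiallyI[of "max N (Suc i)"])
  qed
  show ?thesis
    using mult nonneg le1 lim by (intro exI[of _ \<phi>]) simp
qed

section \<open>Continuity of the transition operator and the Markov property at integer
  times\<close>

context standard_markov_process
begin

lemma prob_space_P: "prob_space (P x)"
  using usual[of x] by (simp add: usual_filtered_space_def)

lemma sets_F_subset: "sets (F x t) \<subseteq> sets (P x)"
  using usual[of x] by (simp add: usual_filtered_space.sets_F_subset)

lemma space_F: "space (F x t) = \<Omega>"
  using usual[of x] space_P[of x] by (simp add: usual_filtered_space_def filtration_def)

lemma filtration_F: "filtration \<Omega> (F x)"
  using usual[of x] space_P[of x] by (simp add: usual_filtered_space_def)

lemma measurable_from_F: "f \<in> measurable (F x t) N \<Longrightarrow> f \<in> measurable (P x) N"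
  using measurable_mono[of N N "F x t" "P x"] sets_F_subset space_F space_P by auto

lemma measurable_F_mono: "s \<le> t \<Longrightarrow> f \<in> measurable (F x s) N \<Longrightarrow> f \<in> measurable (F x t) N"
  using measurable_mono[of N N "F x s" "F x t"] filtration.sets_F_mono[OF filtration_F] space_F by auto

lemma measurable_X: "t < \<infinity> \<Longrightarrow> X t \<in> borel_measurable (P x)"
  by (rule measurable_from_F[OF adapted])

lemma continuous_comp_X:
  "continuous_on UNIV f \<Longrightarrow> t < \<infinity> \<Longrightarrow> (\<lambda>\<omega>. f (X t \<omega>)) \<in> borel_measurable (P x)"
  by (rule measurable_compose[OF measurable_X borel_measurable_continuous_onI])

text \<open>Replacing \<open>f\<close> by \<open>\<phi> n * f\<close> costs at most
  \<open>B * (1 - transition P X t (\<phi> n) x)\<close>. For fixed \<open>n\<close> this bound is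
  continuous in \<open>x\<close>, so once it is small at \<open>x0\<close> it is small on a
  neighbourhood, where a continuous function then approximates the transition of
  \<open>f\<close>.\<close>

lemma transition_continuous:
  assumes lc: "locally_compact_space (euclidean :: 'e topology)"
    and sep: "separable_space (euclidean :: 'e topology)"
    and C0: "C0_Feller P X" and t: "t < \<infinity>"
    and f: "continuous_on UNIV f" "bounded (range f)"
  shows "continuous_on UNIV (transition P X t f)"
proof -
  obtain \<phi> :: "nat \<Rightarrow> 'e \<Rightarrow> real" where \<phi>:
    "\<And>n f. continuous_on UNIV f \<Longrightarrow> bounded (range f) \<Longrightarrow> (\<lambda>y. \<phi> n y * f y) \<in> C0"
    "\<And>n y. 0 \<le> \<phi> n y" "\<And>n y. \<phi> n y \<le> 1" "\<And>y. (\<lambda>n. \<phi> n y) \<longlonglongrightarrow> 1"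
    using exists_C0_approx_unit[OF lc sep] by blast
  have \<phi>C0: "\<phi> n \<in> C0" for n
    using \<phi>(1)[of "\<lambda>_. 1" n] by simp
  obtain B where B: "\<And>y. \<bar>f y\<bar> \<le> B" and B0: "0 < B"
    using f(2) by (auto simp: bounded_pos)
  have \<phi>c: "continuous_on UNIV (\<phi> n)" for n
    using \<phi>C0 by (simp add: C0_def)
  note m = continuous_comp_X[OF _ t]
  have trans1: "continuous_on UNIV (transition P X t (\<phi> n))" for n
    using C0 \<phi>C0 t by (auto simp: C0_Feller_def C0_def)
  have trans2: "continuous_on UNIV (transition P X t (\<lambda>y. \<phi> n y * f y))" for n
  proof -
    have "transition P X t (\<lambda>y. \<phi> n y * f y) \<in> C0"
      using C0 \<phi>(1)[OF f] t by (auto simp: C0_Feller_def)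
    then show ?thesis
      by (simp add: C0_def)
  qed
  have close: "\<bar>transition P X t f x - transition P X t (\<lambda>y. \<phi> n y * f y) x\<bar>
      \<le> B * (1 - transition P X t (\<phi> n) x)" for n x
  proof -
    interpret prob_space "P x" by (rule prob_space_P)
    have i1: "integrable (P x) (\<lambda>\<omega>. f (X t \<omega>))"
      by (rule integrable_const_bound[of _ B]) (auto simp: B m f)
    have i2: "integrable (P x) (\<lambda>\<omega>. \<phi> n (X t \<omega>))"
      by (rule integrable_const_bound[of _ 1]) (auto simp: \<phi> m \<phi>c)
    have i3: "integrable (P x) (\<lambda>\<omega>. \<phi> n (X t \<omega>) * f (X t \<omega>))"
    proof (rule integrable_const_bound[of _ B])
      show "AE \<omega> in P x. norm (\<phi> n (X t \<omega>) * f (X t \<omega>)) \<le> B"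
      proof (intro AE_I2)
        fix \<omega>
        have "\<bar>\<phi> n (X t \<omega>)\<bar> * \<bar>f (X t \<omega>)\<bar> \<le> 1 * B"
          by (rule mult_mono) (auto simp: \<phi> B)
        then show "norm (\<phi> n (X t \<omega>) * f (X t \<omega>)) \<le> B"
          by (simp add: abs_mult)
      qed
    qed (intro borel_measurable_times m \<phi>c f)
    have "transition P X t f x - transition P X t (\<lambda>y. \<phi> n y * f y) x
        = (\<integral>\<omega>. f (X t \<omega>) - \<phi> n (X t \<omega>) * f (X t \<omega>) \<partial>P x)"
      using i1 i3 by (simp add: transition_def)
    also have "\<bar>\<dots>\<bar> \<le> (\<integral>\<omega>. \<bar>f (X t \<omega>) - \<phi> n (X t \<omega>) * f (X t \<omega>)\<bar> \<partial>P x)"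
      by (rule integral_abs_bound)
    also have "\<dots> \<le> (\<integral>\<omega>. B * (1 - \<phi> n (X t \<omega>)) \<partial>P x)"
    proof (rule integral_mono)
      fix \<omega>
      have "\<bar>f (X t \<omega>) - \<phi> n (X t \<omega>) * f (X t \<omega>)\<bar> = \<bar>f (X t \<omega>)\<bar> * \<bar>1 - \<phi> n (X t \<omega>)\<bar>"
        by (simp add: abs_mult[symmetric] algebra_simps)
      also have "\<dots> \<le> B * \<bar>1 - \<phi> n (X t \<omega>)\<bar>"
        by (rule mult_right_mono) (auto simp: B)
      finally show "\<bar>f (X t \<omega>) - \<phi> n (X t \<omega>) * f (X t \<omega>)\<bar> \<le> B * (1 - \<phi> n (X t \<omega>))"
        using \<phi>(3)[of n "X t \<omega>"] by simp
    qed (use i1 i2 i3 in auto)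
    also have "\<dots> = B * (1 - transition P X t (\<phi> n) x)"
      using i2 by (simp add: transition_def prob_space)
    finally show ?thesis .
  qed
  show ?thesis
    unfolding continuous_on_def
  proof (intro ballI)
    fix x0 :: 'e
    interpret prob_space "P x0" by (rule prob_space_P)
    have "(\<lambda>n. transition P X t (\<phi> n) x0) \<longlonglongrightarrow> (\<integral>\<omega>. 1 \<partial>P x0)"
      unfolding transition_def
      by (rule integral_dominated_convergence[where w="\<lambda>_. 1"]) (auto simp: \<phi> m \<phi>c)
    then have lim: "(\<lambda>n. transition P X t (\<phi> n) x0) \<longlonglongrightarrow> 1"
      by (simp add: prob_space)
    show "(transition P X t f \<longlongrightarrow> transition P X t f x0) (at x0)"
    proof (rule tendstoI)
      fix \<epsilon> :: real assume \<epsilon>: "0 < \<epsilon>"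
      \<comment> \<open>The truncation errors at \<open>x\<close> and at \<open>x0\<close> then stay
        below \<open>\<epsilon> / 4\<close> each, and the continuous middle term contributes another
        \<open>\<epsilon> / 4\<close>.\<close>
      define \<delta> where "\<delta> = \<epsilon> / (4 * B)"
      have \<delta>: "0 < \<delta>" "B * \<delta> = \<epsilon> / 4"
        using \<epsilon> B0 by (auto simp: \<delta>_def)
      have "eventually (\<lambda>n. 1 - \<delta> < transition P X t (\<phi> n) x0) sequentially"
        by (rule order_tendstoD(1)[OF lim]) (use \<delta> in auto)
      then obtain n where n: "1 - \<delta> < transition P X t (\<phi> n) x0"
        by (meson eventually_happens trivial_limit_sequentially)
      have bnd: "B * (1 - p) < \<epsilon> / 4" if "1 - \<delta> < p" for p
        using that mult_strict_left_mono[of "1 - p" \<delta> B] B0 \<delta> by auto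
      have "(transition P X t (\<phi> n) \<longlongrightarrow> transition P X t (\<phi> n) x0) (at x0)"
        using trans1 by (auto simp: continuous_on_def)
      then have "eventually (\<lambda>x. 1 - \<delta> < transition P X t (\<phi> n) x) (at x0)"
        using n by (rule order_tendstoD(1))
      moreover have "(transition P X t (\<lambda>y. \<phi> n y * f y) \<longlongrightarrow> transition P X t (\<lambda>y. \<phi> n y * f y) x0) (at x0)"
        using trans2 by (auto simp: continuous_on_def)
      then have "eventually (\<lambda>x. dist (transition P X t (\<lambda>y. \<phi> n y * f y) x)
          (transition P X t (\<lambda>y. \<phi> n y * f y) x0) < \<epsilon> / 4) (at x0)"
        by (rule tendstoD) (use \<epsilon> in auto)
      ultimately show "eventually (\<lambda>x. dist (transition P X t f x) (transition P X t f x0) < \<epsilon>) (at x0)"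
      proof eventually_elim
        case (elim x)
        show ?case
          using close[of x n] close[of x0 n] bnd[OF n] bnd[OF elim(1)] elim(2) \<epsilon>
          unfolding dist_real_def by linarith
      qed
    qed
  qed
qed

text \<open>This is the strong Markov property at the constant time \<open>n\<close>. The
  pre-sigma-algebra there has the same sets as \<open>F x (of_nat n)\<close>, so the weight
  \<open>Y\<close> can be taken out of the conditional expectation.\<close>

lemma markov_property:
  assumes Y: "Y \<in> borel_measurable (F x (of_nat n))" "\<And>\<omega>. \<bar>Y \<omega>\<bar> \<le> C"
    and f: "continuous_on UNIV f" "bounded (range f)" "continuous_on UNIV (transition P X 1 f)"
  shows "(\<integral>\<omega>. Y \<omega> * f (X (of_nat (Suc n)) \<omega>) \<partial>P x)
    = (\<integral>\<omega>. Y \<omega> * transition P X 1 f (X (of_nat n) \<omega>) \<partial>P x)"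
proof -
  interpret filtration \<Omega> "F x" by (rule filtration_F)
  interpret prob_space "P x" by (rule prob_space_P)
  define T :: "'w \<Rightarrow> ennreal" where "T = (\<lambda>_. of_nat n)"
  have T: "stopping_time (F x) T"
    unfolding T_def by (rule stopping_time_const)
  define H where "H = pre_sigma T"
  have sH: "sets H = {A. \<forall>t. {\<omega>\<in>A. T \<omega> \<le> t} \<in> sets (F x t)}"
    unfolding H_def by (rule sets_pre_sigma[OF T])
  \<comment> \<open>Evaluating the defining condition at \<open>t = of_nat n\<close> returns
    \<open>A\<close> itself.\<close>
  have "sets H \<subseteq> sets (F x (of_nat n))"
  proof
    fix A assume "A \<in> sets H"
    then have "{\<omega> \<in> A. T \<omega> \<le> of_nat n} \<in> sets (F x (of_nat n))"
      unfolding sH by blast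
    then show "A \<in> sets (F x (of_nat n))"
      by (simp add: T_def)
  qed
  then have "subalgebra (P x) H"
    using sets_F_subset[of x "of_nat n"]
    unfolding subalgebra_def H_def space_pre_sigma space_P by blast
  then interpret finite_measure_subalgebra "P x" H
    by unfold_locales
  \<comment> \<open>The set is \<open>A\<close> from time \<open>n\<close> on and empty
    before.\<close>
  have "{\<omega> \<in> A. T \<omega> \<le> t} \<in> sets (F x t)" if "A \<in> sets (F x (of_nat n))" for A t
    using that sets_F_mono[of "of_nat n" t] by (cases "of_nat n \<le> t") (auto simp: T_def)
  then have "sets (F x (of_nat n)) \<subseteq> sets H"
    unfolding sH by auto
  then have YH: "Y \<in> borel_measurable H"
    using Y(1) measurable_mono[of borel borel "F x (of_nat n)" H] space_F space_pre_sigma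
    unfolding H_def by auto
  have fin: "of_nat k < (\<infinity> :: ennreal)" for k
    by (simp add: of_nat_less_top)
  let ?f = "\<lambda>\<omega>. f (X (of_nat (Suc n)) \<omega>)"
  have mf: "?f \<in> borel_measurable (P x)"
    using continuous_comp_X[OF f(1) fin] .
  have mY: "Y \<in> borel_measurable (P x)"
    by (rule measurable_from_F[OF Y(1)])
  obtain B where B: "\<And>y. \<bar>f y\<bar> \<le> B"
    using f(2) by (auto simp: bounded_iff)
  have int: "integrable (P x) (\<lambda>\<omega>. Y \<omega> * ?f \<omega>)"
  proof (rule integrable_const_bound[of _ "C * B"])
    show "AE \<omega> in P x. norm (Y \<omega> * ?f \<omega>) \<le> C * B"
    proof (intro AE_I2)
      fix \<omega>
      have "0 \<le> C"
        using Y(2)[of \<omega>] by linarith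
      then show "norm (Y \<omega> * ?f \<omega>) \<le> C * B"
        using mult_mono[OF Y(2)[of \<omega>] B[of "X (of_nat (Suc n)) \<omega>"]] by (simp add: abs_mult)
    qed
  qed (intro borel_measurable_times mf mY)
  \<comment> \<open>The indicator of \<open>T < \<infinity>\<close> is constantly 1, and
    \<open>T + 1\<close> is the time \<open>Suc n\<close>.\<close>
  have "AE \<omega> in P x. real_cond_exp (P x) H ?f \<omega> = transition P X 1 f (X (of_nat n) \<omega>)"
    using strong_markov[OF T _ borel_measurable_continuous_onI[OF f(1)] f(2), where t=1]
    by (simp add: H_def[symmetric], simp add: T_def of_nat_less_top add.commute)
  then have "AE \<omega> in P x. Y \<omega> * real_cond_exp (P x) H ?f \<omega>
      = Y \<omega> * transition P X 1 f (X (of_nat n) \<omega>)"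
    by eventually_elim simp
  then have "(\<integral>\<omega>. Y \<omega> * real_cond_exp (P x) H ?f \<omega> \<partial>P x)
      = (\<integral>\<omega>. Y \<omega> * transition P X 1 f (X (of_nat n) \<omega>) \<partial>P x)"
    by (intro integral_cong_AE borel_measurable_times mY continuous_comp_X[OF f(3) fin] borel_measurable_cond_exp2)
  then show ?thesis
    using real_cond_exp_intg(2)[OF int YH mf] by simp
qed

end

section \<open>Bellman's equation\<close>

text \<open>\<open>b\<close> and \<open>d\<close> are upper bounds of \<open>G\<close> and
  \<open>g\<close>; \<open>Feller\<close> is the one-step instance of
  \<open>transition_continuous\<close>.\<close>

locale exponential_stopping = standard_markov_process \<Omega> P F X
  for \<Omega> :: "'w set"
    and P :: "'e::metric_space \<Rightarrow> 'w measure"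
    and F :: "'e \<Rightarrow> ennreal \<Rightarrow> 'w measure"
    and X :: "ennreal \<Rightarrow> 'w \<Rightarrow> 'e" +
  fixes g G :: "'e \<Rightarrow> real" and b c d :: real
  assumes Feller: "\<And>f. continuous_on UNIV f \<Longrightarrow> bounded (range f) \<Longrightarrow>
      continuous_on UNIV (transition P X 1 f)"
    and g_cont: "continuous_on UNIV g" and G_cont: "continuous_on UNIV G"
    and c_pos: "0 < c" and g_ge: "\<And>y. c \<le> g y" and g_le: "\<And>y. g y \<le> d"
    and G_ge: "\<And>y. 0 \<le> G y" and G_le: "\<And>y. G y \<le> b"
begin

lemma integrable_X:
  fixes f :: "'e \<Rightarrow> real"
  assumes "continuous_on UNIV f" "bounded (range f)"
  shows "integrable (P x) (\<lambda>\<omega>. f (X (of_nat n) \<omega>))"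
proof -
  interpret prob_space "P x" by (rule prob_space_P)
  obtain B where "\<And>y. \<bar>f y\<bar> \<le> B"
    using assms(2) by (auto simp: bounded_iff)
  then show ?thesis
    by (intro integrable_const_bound[of _ B] continuous_comp_X assms) (auto simp: of_nat_less_top)
qed

lemma integrable_X1:
  fixes f :: "'e \<Rightarrow> real"
  assumes "continuous_on UNIV f" "bounded (range f)"
  shows "integrable (P x) (\<lambda>\<omega>. f (X 1 \<omega>))"
  using integrable_X[OF assms, of x 1] by simp

lemma transition_mono:
  assumes "continuous_on UNIV f" "bounded (range f)" "continuous_on UNIV h" "bounded (range h)"
    and "\<And>y. f y \<le> h y"
  shows "transition P X 1 f x \<le> transition P X 1 h x"
  unfolding transition_def by (intro integral_mono integrable_X1 assms)

lemma transition_const: "transition P X 1 (\<lambda>_. r) x = r"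
  using prob_space.prob_space[OF prob_space_P] by (simp add: transition_def)

lemma transition_affine:
  assumes "continuous_on UNIV f" "bounded (range f)"
  shows "transition P X 1 (\<lambda>y. r * f y + s) x = r * transition P X 1 f x + s"
proof -
  interpret prob_space "P x" by (rule prob_space_P)
  show ?thesis
    using integrable_X1[OF assms, of x] by (simp add: transition_def prob_space)
qed

section \<open>The Bellman operator, its iterates and their limit\<close>

definition bellman :: "('e \<Rightarrow> real) \<Rightarrow> 'e \<Rightarrow> real" where
  "bellman f x = min (exp (G x)) (exp (g x) * transition P X 1 f x)"

text \<open>Starting from 1 matches the problem with horizon \<open>n\<close> that charges no
  \<open>G\<close> at time \<open>n\<close>, as in \<open>lower_cost\<close>.\<close>

definition iter :: "nat \<Rightarrow> 'e \<Rightarrow> real" where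
  "iter n = (bellman ^^ n) (\<lambda>_. 1)"

lemma iter_0 [simp]: "iter 0 x = 1"
  by (simp add: iter_def)

lemma iter_Suc: "iter (Suc n) x = bellman (iter n) x"
  by (simp add: iter_def)

lemma bounded_rangeI: "(\<And>y. 0 \<le> f y) \<Longrightarrow> (\<And>y. f y \<le> r) \<Longrightarrow> bounded (range f)" for f :: "'e \<Rightarrow> real"
  by (rule boundedI[of _ r]) auto

lemma g_nonneg: "0 \<le> g y"
  using c_pos g_ge[of y] by linarith

text \<open>Continuity and bounds share one induction, since the bounds make an iterate eligible for
  \<open>Feller\<close>, which yields continuity of the next one.\<close>

lemma iter_props: "continuous_on UNIV (iter n) \<and> (\<forall>y. 1 \<le> iter n y \<and> iter n y \<le> exp (G y))"
proof (induction n)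
  case 0
  then show ?case
    by (simp add: iter_def G_ge)
next
  case (Suc n)
  have cont: "continuous_on UNIV (iter n)" and bd: "bounded (range (iter n))"
    using Suc G_le by (auto intro!: bounded_rangeI[of _ "exp b"] intro: order_trans[of 0 1] order_trans[of _ "exp (G _)"])
  have "1 \<le> transition P X 1 (iter n) x" for x
    using transition_mono[of "\<lambda>_. 1" "iter n" x] cont bd Suc transition_const[of 1 x] by simp
  then have "1 * 1 \<le> exp (g x) * transition P X 1 (iter n) x" for x
    using g_nonneg by (intro mult_mono) auto
  moreover have "continuous_on UNIV (bellman (iter n))"
    unfolding bellman_def by (intro continuous_intros Feller cont bd g_cont G_cont)
  ultimately show ?case
    using G_ge by (auto simp: iter_Suc bellman_def iter_def[of "Suc n"] iter_def[of n, symmetric])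
qed

lemma iter_cont: "continuous_on UNIV (iter n)"
  and iter_ge: "1 \<le> iter n y" and iter_le: "iter n y \<le> exp (G y)"
  using iter_props[of n] by auto

lemma exp_G_le: "exp (G y) \<le> exp b"
  using G_le by simp

lemma iter_le_bound: "iter n y \<le> exp b"
  using iter_le[of n y] exp_G_le[of y] by linarith

lemma iter_bounded: "bounded (range (iter n))"
  by (rule bounded_rangeI[of _ "exp b"]) (use iter_ge iter_le_bound in \<open>auto intro: order_trans[of 0 1]\<close>)

text \<open>The Bellman operator is monotone, and the first step goes up because
  \<open>iter 0\<close> is the common lower bound 1 of all iterates.\<close>

lemma iter_le_Suc: "iter n x \<le> iter (Suc n) x"
proof (induction n arbitrary: x)
  case 0
  then show ?case
    using iter_ge[of "Suc 0" x] by simp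
next
  case (Suc n)
  have "transition P X 1 (iter n) x \<le> transition P X 1 (iter (Suc n)) x"
    by (intro transition_mono iter_cont iter_bounded Suc)
  then have "exp (g x) * transition P X 1 (iter n) x \<le> exp (g x) * transition P X 1 (iter (Suc n)) x"
    by simp
  then show ?case
    unfolding iter_Suc bellman_def iter_Suc[symmetric] by (intro min.mono) auto
qed

definition w :: "'e \<Rightarrow> real" where
  "w x = (SUP n. iter n x)"

lemma bdd_above_iter: "bdd_above (range (\<lambda>n. iter n x))"
  using iter_le by (auto simp: bdd_above_def)

lemma iter_tendsto_w: "(\<lambda>n. iter n x) \<longlonglongrightarrow> w x"
  unfolding w_def by (intro LIMSEQ_incseq_SUP bdd_above_iter incseq_SucI iter_le_Suc)

lemma iter_le_w: "iter n x \<le> w x"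
  unfolding w_def by (intro cSUP_upper bdd_above_iter) simp

lemma w_ge: "1 \<le> w x"
  using iter_le_w[of 0 x] by simp

lemma w_le: "w x \<le> exp (G x)"
  unfolding w_def by (intro cSUP_least) (auto intro: iter_le)

lemma w_le_bound: "w x \<le> exp b"
  using w_le[of x] exp_G_le[of x] by linarith

lemma w_bounded: "bounded (range w)"
  by (rule bounded_rangeI[of _ "exp b"]) (use w_ge w_le_bound in \<open>auto intro: order_trans[of 0 1]\<close>)

text \<open>Integrals of \<open>w\<close> are needed before its continuity is known; being a
  pointwise limit of continuous functions suffices for them.\<close>

lemma w_measurable: "w \<in> borel_measurable borel"
  by (rule borel_measurable_LIMSEQ_real[OF iter_tendsto_w])
    (rule borel_measurable_continuous_onI[OF iter_cont])

lemma transition_iter_tendsto: "(\<lambda>n. transition P X 1 (iter n) x) \<longlonglongrightarrow> transition P X 1 w x"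
proof -
  interpret prob_space "P x" by (rule prob_space_P)
  show ?thesis
    unfolding transition_def
  proof (rule integral_dominated_convergence[where w="\<lambda>_. exp b"])
    show "(\<lambda>\<omega>. w (X 1 \<omega>)) \<in> borel_measurable (P x)"
      by (rule measurable_compose[OF measurable_X w_measurable]) simp
    show "AE \<omega> in P x. norm (iter n (X 1 \<omega>)) \<le> exp b" for n
      using iter_le_bound[of n] iter_ge[of n] by (auto intro!: AE_I2 simp: abs_of_nonneg order_trans[OF zero_le_one])
  qed (auto simp: continuous_comp_X iter_cont iter_tendsto_w)
qed

text \<open>By dominated convergence \<open>bellman\<close> passes to the limit, so the shifted
  iterates converge to both sides.\<close>

lemma w_fixed_point: "w x = bellman w x"
proof -
  have "(\<lambda>n. iter (Suc n) x) \<longlonglongrightarrow> bellman w x"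
    unfolding iter_Suc bellman_def by (intro tendsto_intros transition_iter_tendsto)
  then show ?thesis
    using LIMSEQ_unique LIMSEQ_Suc[OF iter_tendsto_w] by blast
qed

section \<open>Geometric convergence of the iterates and continuity of the limit\<close>

definition a :: real where "a = exp (- c)"

text \<open>\<open>\<kappa>\<close> is the least constant with \<open>y - 1 \<le> \<kappa> * (y - a)\<close> for all \<open>y\<close> in \<open>{1..exp b}\<close>, the range
  containing the values of \<open>w\<close>.\<close>

definition \<kappa> :: real where "\<kappa> = (exp b - 1) / (exp b - a)"

text \<open>The value of \<open>a\<close> is dictated by the lower bound \<open>c\<close> of
  \<open>g\<close>: one continuation step lifts the constant \<open>a\<close> to at least 1.\<close>

lemma a_pos: "0 < a" and a_less_1: "a < 1" and exp_g_a: "1 \<le> exp (g x) * a"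
  using c_pos g_ge[of x] by (auto simp: a_def exp_add[symmetric])

lemma one_le_exp_b: "1 \<le> exp b"
  using G_ge G_le[of undefined] by (auto intro: order_trans)

lemma a_less_exp_b: "a < exp b"
  using one_le_exp_b a_less_1 by linarith

lemma \<kappa>_nonneg: "0 \<le> \<kappa>" and \<kappa>_less_1: "\<kappa> < 1"
  using one_le_exp_b a_less_1 a_less_exp_b by (simp_all add: \<kappa>_def)

text \<open>Clearing the denominator \<open>exp b - a\<close> reduces the claim to
  \<open>y * (1 - a) \<le> exp b * (1 - a)\<close>.\<close>

lemma \<kappa>_bound:
  assumes "y \<le> exp b"
  shows "y - 1 \<le> \<kappa> * (y - a)"
proof -
  have "y * (1 - a) \<le> exp b * (1 - a)"
    using assms a_less_1 by (intro mult_right_mono) auto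
  then have "(y - 1) * (exp b - a) \<le> (exp b - 1) * (y - a)"
    by (simp add: algebra_simps)
  then have "y - 1 \<le> (exp b - 1) * (y - a) / (exp b - a)"
    using a_less_exp_b by (subst pos_le_divide_eq) auto
  then show ?thesis
    by (simp add: \<kappa>_def)
qed

text \<open>In the continuation branch, linearity of the transition gives at least
  \<open>(1 - \<kappa> ^ n) * w x + \<kappa> ^ n\<close>, which is
  \<open>w x - \<kappa> ^ n * (w x - 1)\<close>; \<open>\<kappa>_bound\<close> then gains one more
  factor \<open>\<kappa>\<close>. In the stopping branch, a convex combination of \<open>w x\<close>
  and the smaller \<open>a\<close> stays below \<open>w x\<close>, hence below
  \<open>exp (G x)\<close>.\<close>

lemma iter_lower_bound: "(1 - \<kappa> ^ n) * w x + \<kappa> ^ n * a \<le> iter n x"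
proof (induction n arbitrary: x)
  case 0
  then show ?case
    using a_less_1 by simp
next
  case (Suc n)
  have pow: "0 \<le> \<kappa> ^ k" "\<kappa> ^ k \<le> 1" for k
    using \<kappa>_nonneg \<kappa>_less_1 by (auto intro: power_le_one)
  have wa: "a \<le> w x"
    using a_less_1 w_ge[of x] by linarith
  have "(1 - \<kappa> ^ Suc n) * w x + \<kappa> ^ Suc n * a \<le> w x"
    using mult_left_mono[OF wa pow(1)[of "Suc n"]] by (simp add: algebra_simps)
  then have 1: "(1 - \<kappa> ^ Suc n) * w x + \<kappa> ^ Suc n * a \<le> exp (G x)"
    using w_le[of x] by linarith
  have P1: "(1 - \<kappa> ^ n) * transition P X 1 w x + \<kappa> ^ n * a \<le> transition P X 1 (iter n) x"
  proof -
    interpret prob_space "P x" by (rule prob_space_P)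
    \<comment> \<open>\<open>integrable_X1\<close> asks for continuity, which \<open>w\<close> only
      receives through the present lemma.\<close>
    have i: "integrable (P x) (\<lambda>\<omega>. w (X 1 \<omega>))"
    proof (rule integrable_const_bound[of _ "exp b"])
      show "AE \<omega> in P x. norm (w (X 1 \<omega>)) \<le> exp b"
        using w_le_bound w_ge by (auto intro!: AE_I2 simp: abs_of_nonneg order_trans[OF zero_le_one])
    qed (rule measurable_compose[OF measurable_X w_measurable], simp)
    have "(1 - \<kappa> ^ n) * transition P X 1 w x + \<kappa> ^ n * a
        = (\<integral>\<omega>. (1 - \<kappa> ^ n) * w (X 1 \<omega>) + \<kappa> ^ n * a \<partial>P x)"
      using i by (simp add: transition_def prob_space)
    also have "\<dots> \<le> transition P X 1 (iter n) x"
      unfolding transition_def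
    proof (rule integral_mono)
      show "integrable (P x) (\<lambda>\<omega>. (1 - \<kappa> ^ n) * w (X 1 \<omega>) + \<kappa> ^ n * a)"
        using i by simp
    qed (intro integrable_X1 iter_cont iter_bounded Suc)+
    finally show ?thesis .
  qed
  have "w x \<le> exp (g x) * transition P X 1 w x"
    using w_fixed_point[of x] by (simp add: bellman_def min_def split: if_splits)
  then have "(1 - \<kappa> ^ n) * w x \<le> (1 - \<kappa> ^ n) * (exp (g x) * transition P X 1 w x)"
    using pow[of n] by (intro mult_left_mono) auto
  moreover have "\<kappa> ^ n * 1 \<le> \<kappa> ^ n * (exp (g x) * a)"
    using exp_g_a[of x] pow[of n] by (intro mult_left_mono) auto
  moreover have "exp (g x) * ((1 - \<kappa> ^ n) * transition P X 1 w x + \<kappa> ^ n * a)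
      \<le> exp (g x) * transition P X 1 (iter n) x"
    using P1 by simp
  moreover have "\<kappa> ^ n * (w x - 1) \<le> \<kappa> ^ n * (\<kappa> * (w x - a))"
    using \<kappa>_bound[OF w_le_bound[of x]] pow[of n] by (intro mult_left_mono) auto
  ultimately have "(1 - \<kappa> ^ Suc n) * w x + \<kappa> ^ Suc n * a \<le> exp (g x) * transition P X 1 (iter n) x"
    by (simp add: algebra_simps)
  then show ?case
    using 1 by (simp add: iter_Suc bellman_def)
qed

lemma \<kappa>_power_tendsto: "(\<lambda>n. \<kappa> ^ n) \<longlonglongrightarrow> 0"
  using \<kappa>_nonneg \<kappa>_less_1 by (intro LIMSEQ_power_zero) auto

lemma w_cont: "continuous_on UNIV w"
proof (rule uniform_limit_theorem[where F=sequentially])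
  show "\<forall>\<^sub>F n in sequentially. continuous_on UNIV (iter n)"
    by (simp add: iter_cont)
  show "uniform_limit UNIV iter w sequentially"
  proof (rule uniform_limitI)
    fix e :: real assume e: "0 < e"
    have "(\<lambda>n. \<kappa> ^ n * exp b) \<longlonglongrightarrow> 0 * exp b"
      by (intro tendsto_intros \<kappa>_power_tendsto)
    then have "\<forall>\<^sub>F n in sequentially. \<kappa> ^ n * exp b < e"
      using e by (intro order_tendstoD(2)) auto
    then show "\<forall>\<^sub>F n in sequentially. \<forall>x\<in>UNIV. dist (iter n x) (w x) < e"
    proof eventually_elim
      case (elim n)
      have "dist (iter n x) (w x) < e" for x
      proof -
        have "w x - iter n x \<le> \<kappa> ^ n * (w x - a)"
          using iter_lower_bound[of n x] by (simp add: algebra_simps)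
        also have "\<dots> \<le> \<kappa> ^ n * exp b"
          using w_le_bound[of x] a_pos \<kappa>_nonneg by (intro mult_left_mono) auto
        finally show ?thesis
          using elim iter_le_w[of n x] by (simp add: dist_real_def)
      qed
      then show ?case
        by simp
    qed
  qed
qed simp

section \<open>Stopped costs\<close>

lemma transition_bounded:
  assumes "continuous_on UNIV f" "bounded (range f)"
  shows "bounded (range (transition P X 1 f))"
proof -
  obtain B where B: "\<And>y. \<bar>f y\<bar> \<le> B"
    using assms(2) by (auto simp: bounded_iff)
  have le: "f y \<le> B" "- B \<le> f y" for y
    using B[of y] by linarith+
  have "\<bar>transition P X 1 f x\<bar> \<le> B" for x
    using transition_mono[of f "\<lambda>_. B" x] transition_mono[of "\<lambda>_. - B" f x]
      transition_const[of B x] transition_const[of "- B" x] assms le by simp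
  then show ?thesis
    by (auto simp: bounded_iff)
qed

lemma exp_g_transition_cont:
  "continuous_on UNIV f \<Longrightarrow> bounded (range f) \<Longrightarrow> continuous_on UNIV (\<lambda>y. exp (g y) * transition P X 1 f y)"
  by (intro continuous_intros g_cont Feller)

lemma exp_g_transition_bounded:
  assumes "continuous_on UNIV f" "bounded (range f)"
  shows "bounded (range (\<lambda>y. exp (g y) * transition P X 1 f y))"
proof -
  obtain B where B: "\<And>y. \<bar>transition P X 1 f y\<bar> \<le> B"
    using transition_bounded[OF assms] by (auto simp: bounded_iff)
  have "\<bar>exp (g y) * transition P X 1 f y\<bar> \<le> exp d * B" for y
    unfolding abs_mult using B g_le by (intro mult_mono) auto
  then show ?thesis
    by (auto simp: bounded_iff)
qed

lemma continuous_comp_X_F: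
  assumes "continuous_on UNIV f" "i \<le> n"
  shows "(\<lambda>\<omega>. f (X (of_nat i) \<omega>)) \<in> borel_measurable (F x (of_nat n))"
  by (rule measurable_F_mono[of "of_nat i"])
    (auto intro!: measurable_compose[OF adapted borel_measurable_continuous_onI] assms
      simp: of_nat_less_top)

text \<open>The accumulated running cost over the times strictly before \<open>n\<close>. It is a
  growth factor, not a discount: it is at least 1.\<close>

definition disc :: "nat \<Rightarrow> 'w \<Rightarrow> real" where
  "disc n \<omega> = exp (\<Sum>i<n. g (X (of_nat i) \<omega>))"

lemma disc_0 [simp]: "disc 0 \<omega> = 1"
  by (simp add: disc_def)

lemma disc_Suc: "disc (Suc n) \<omega> = disc n \<omega> * exp (g (X (of_nat n) \<omega>))"
  by (simp add: disc_def exp_add)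

lemma disc_ge: "1 \<le> disc n \<omega>"
  by (simp add: disc_def sum_nonneg g_nonneg)

lemma disc_nonneg: "0 \<le> disc n \<omega>"
  by (simp add: disc_def)

lemma disc_le: "disc n \<omega> \<le> exp (real n * d)"
  using sum_bounded_above[of "{..<n}" "\<lambda>i. g (X (of_nat i) \<omega>)" d] by (simp add: disc_def g_le)

text \<open>The last state entering \<open>disc n\<close> is the one at time \<open>n - 1\<close>,
  so even \<open>disc (Suc m)\<close> is known at time \<open>m\<close>; \<open>markov_disc\<close>
  relies on this shift.\<close>

lemma disc_measurable_F: "n \<le> Suc m \<Longrightarrow> disc n \<in> borel_measurable (F x (of_nat m))"
  unfolding disc_def
  by (intro borel_measurable_exp[THEN measurable_compose_rev] borel_measurable_sum
      continuous_comp_X_F g_cont) auto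

lemma disc_measurable: "disc n \<in> borel_measurable (P x)"
  by (rule measurable_from_F[OF disc_measurable_F[OF le_SucI[OF le_refl]]])

lemma cost_eq_disc: "cost X g G n \<omega> = disc n \<omega> * exp (G (X (of_nat n) \<omega>))"
  by (simp add: cost_def disc_def exp_add)

lemma integrable_disc:
  fixes f :: "'e \<Rightarrow> real"
  assumes "Measurable.pred (P x) Q" "continuous_on UNIV f" "bounded (range f)"
  shows "integrable (P x) (\<lambda>\<omega>. of_bool (Q \<omega>) * (disc n \<omega> * f (X (of_nat m) \<omega>)))"
proof -
  interpret prob_space "P x" by (rule prob_space_P)
  obtain B where B: "\<And>y. \<bar>f y\<bar> \<le> B"
    using assms(3) by (auto simp: bounded_iff)
  have B0: "0 \<le> B"
    using B[of undefined] by linarith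
  show ?thesis
  proof (rule integrable_const_bound[of _ "exp (real n * d) * B"])
    show "AE \<omega> in P x. norm (of_bool (Q \<omega>) * (disc n \<omega> * f (X (of_nat m) \<omega>))) \<le> exp (real n * d) * B"
    proof (intro AE_I2)
      fix \<omega>
      have "norm (disc n \<omega> * f (X (of_nat m) \<omega>)) \<le> exp (real n * d) * B"
        using mult_mono[OF disc_le[of n \<omega>] B[of "X (of_nat m) \<omega>"]] disc_nonneg[of n \<omega>]
        by (simp add: abs_mult)
      then show "norm (of_bool (Q \<omega>) * (disc n \<omega> * f (X (of_nat m) \<omega>))) \<le> exp (real n * d) * B"
        using B0 by (cases "Q \<omega>") auto
    qed
    have "(\<lambda>\<omega>. of_bool (Q \<omega>) :: real) \<in> borel_measurable (P x)"
      using assms(1) by measurable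
    then show "(\<lambda>\<omega>. of_bool (Q \<omega>) * (disc n \<omega> * f (X (of_nat m) \<omega>))) \<in> borel_measurable (P x)"
      by (intro borel_measurable_times disc_measurable continuous_comp_X assms)
        (auto simp: of_nat_less_top)
  qed
qed

text \<open>The cost of stopping at \<open>\<tau>\<close> when this happens before \<open>n\<close>,
  and otherwise a terminal value \<open>f\<close> at time \<open>n\<close>. Splitting by the value
  of \<open>\<tau>\<close> isolates the one term to which the Markov property is applied.\<close>

definition payoff :: "('w \<Rightarrow> enat) \<Rightarrow> nat \<Rightarrow> ('e \<Rightarrow> real) \<Rightarrow> 'w \<Rightarrow> real" where
  "payoff \<tau> n f \<omega> = (\<Sum>i<n. of_bool (\<tau> \<omega> = enat i) * cost X g G i \<omega>)
     + of_bool (enat n \<le> \<tau> \<omega>) * (disc n \<omega> * f (X (of_nat n) \<omega>))"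

lemma payoff_eq: "payoff \<tau> n f \<omega> =
    (if \<tau> \<omega> < enat n then cost X g G (the_enat (\<tau> \<omega>)) \<omega> else disc n \<omega> * f (X (of_nat n) \<omega>))"
proof (cases "\<tau> \<omega>")
  case (enat j)
  have "(\<Sum>i<n. of_bool (j = i) * cost X g G i \<omega>)
      = (\<Sum>i<n. if j = i then cost X g G i \<omega> else 0)"
    by (intro sum.cong) auto
  then show ?thesis
    using enat by (simp add: payoff_def)
qed (simp add: payoff_def)

section \<open>Integer-valued stopping times and backward dynamic programming\<close>

definition discrete_stopping :: "'e \<Rightarrow> ('w \<Rightarrow> enat) \<Rightarrow> bool" where
  "discrete_stopping x \<tau> \<longleftrightarrow> stopping_time (\<lambda>i. F x (ennreal_of_enat i)) \<tau>"

lemma filtration_enat: "filtration \<Omega> (\<lambda>i. F x (ennreal_of_enat i))"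
  using filtration.sets_F_mono[OF filtration_F] by unfold_locales (auto simp: space_F)

lemma discrete_stopping_F:
  assumes "discrete_stopping x \<tau>"
  shows "Measurable.pred (F x (of_nat n)) (\<lambda>\<omega>. \<tau> \<omega> = enat n)"
    and "Measurable.pred (F x (of_nat n)) (\<lambda>\<omega>. enat n < \<tau> \<omega>)"
    and "Measurable.pred (F x (of_nat n)) (\<lambda>\<omega>. enat n \<le> \<tau> \<omega>)"
proof -
  interpret filtration \<Omega> "\<lambda>i. F x (ennreal_of_enat i)"
    by (rule filtration_enat)
  note st = assms[unfolded discrete_stopping_def]
  show "Measurable.pred (F x (of_nat n)) (\<lambda>\<omega>. \<tau> \<omega> = enat n)"
    using stopping_time_eq_const[OF st, of "enat n"] by simp
  show "Measurable.pred (F x (of_nat n)) (\<lambda>\<omega>. enat n < \<tau> \<omega>)"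
    using stopping_timeD2[OF st, of "enat n"] by simp
  show "Measurable.pred (F x (of_nat n)) (\<lambda>\<omega>. enat n \<le> \<tau> \<omega>)"
    using stopping_time_less_const[OF st, of "enat n"]
    unfolding not_less[symmetric] by simp
qed

lemmas discrete_stopping_P = discrete_stopping_F[THEN measurable_from_F]

lemma exp_G_cont: "continuous_on UNIV (\<lambda>y. exp (G y))"
  by (intro continuous_intros G_cont)

lemma exp_G_bounded: "bounded (range (\<lambda>y. exp (G y)))"
  by (rule bounded_rangeI[OF _ exp_G_le]) simp

lemma integrable_stopped_sum:
  assumes "discrete_stopping x \<tau>"
  shows "integrable (P x) (\<lambda>\<omega>. \<Sum>i<n. of_bool (\<tau> \<omega> = enat i) * cost X g G i \<omega>)"
  unfolding cost_eq_disc
  by (intro Bochner_Integration.integrable_sum integrable_disc discrete_stopping_P(1)[OF assms]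
      exp_G_cont exp_G_bounded)

lemma integrable_payoff:
  assumes "discrete_stopping x \<tau>" "continuous_on UNIV f" "bounded (range f)"
  shows "integrable (P x) (payoff \<tau> n f)"
  unfolding payoff_def
  by (intro Bochner_Integration.integrable_add integrable_stopped_sum integrable_disc
      discrete_stopping_P(3)[OF assms(1)] assms)

text \<open>The weight \<open>of_bool (enat n < \<tau> \<omega>) * disc (Suc n) \<omega>\<close> is
  known at time \<open>n\<close>, so \<open>markov_property\<close> applies; its last factor
  \<open>exp g\<close> joins the transition to form the continuation value.\<close>

lemma markov_disc:
  fixes f :: "'e \<Rightarrow> real"
  assumes "discrete_stopping x \<tau>" "continuous_on UNIV f" "bounded (range f)"
  shows "(\<integral>\<omega>. of_bool (enat n < \<tau> \<omega>) * (disc (Suc n) \<omega> * f (X (of_nat (Suc n)) \<omega>)) \<partial>P x)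
    = (\<integral>\<omega>. of_bool (enat n < \<tau> \<omega>)
        * (disc n \<omega> * (exp (g (X (of_nat n) \<omega>)) * transition P X 1 f (X (of_nat n) \<omega>))) \<partial>P x)"
proof -
  have ob: "(\<lambda>\<omega>. of_bool (enat n < \<tau> \<omega>) :: real) \<in> borel_measurable (F x (of_nat n))"
    using discrete_stopping_F(2)[OF assms(1)] by measurable
  have "(\<lambda>\<omega>. of_bool (enat n < \<tau> \<omega>) * disc (Suc n) \<omega>) \<in> borel_measurable (F x (of_nat n))"
    by (intro borel_measurable_times ob disc_measurable_F) simp
  moreover have "\<bar>of_bool (enat n < \<tau> \<omega>) * disc (Suc n) \<omega>\<bar> \<le> exp (real (Suc n) * d)" for \<omega>
    using disc_le[of "Suc n" \<omega>] disc_nonneg[of "Suc n" \<omega>] by (cases "enat n < \<tau> \<omega>") auto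
  ultimately show ?thesis
    using markov_property[of "\<lambda>\<omega>. of_bool (enat n < \<tau> \<omega>) * disc (Suc n) \<omega>" x n
        "exp (real (Suc n) * d)" f] assms(2,3) Feller[OF assms(2,3)]
    by (simp add: disc_Suc mult.assoc)
qed

text \<open>Not having stopped before \<open>Suc n\<close> means \<open>enat n < \<tau>\<close>, so
  the terminal term can be integrated out one step back by \<open>markov_disc\<close>.\<close>

lemma integral_payoff_Suc:
  assumes "discrete_stopping x \<tau>" "continuous_on UNIV f" "bounded (range f)"
  shows "(\<integral>\<omega>. payoff \<tau> (Suc n) f \<omega> \<partial>P x)
    = (\<integral>\<omega>. (\<Sum>i<Suc n. of_bool (\<tau> \<omega> = enat i) * cost X g G i \<omega>)
        + of_bool (enat n < \<tau> \<omega>)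
          * (disc n \<omega> * (exp (g (X (of_nat n) \<omega>)) * transition P X 1 f (X (of_nat n) \<omega>))) \<partial>P x)"
proof -
  have eq: "enat (Suc n) \<le> \<tau> \<omega> \<longleftrightarrow> enat n < \<tau> \<omega>" for \<omega>
    by (rule Suc_ile_eq)
  note int = integrable_stopped_sum[OF assms(1), of "Suc n"]
    integrable_disc[OF discrete_stopping_P(2)[OF assms(1), of n] assms(2,3), of "Suc n" "Suc n"]
    integrable_disc[OF discrete_stopping_P(2)[OF assms(1), of n]
      exp_g_transition_cont[OF assms(2,3)] exp_g_transition_bounded[OF assms(2,3)], of n n]
  show ?thesis
    unfolding payoff_def eq Bochner_Integration.integral_add[OF int(1,2)]
      Bochner_Integration.integral_add[OF int(1,3)] markov_disc[OF assms] ..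
qed

lemma integral_payoff_0:
  assumes "continuous_on UNIV f"
  shows "(\<integral>\<omega>. payoff \<tau> 0 f \<omega> \<partial>P x) = f x"
proof -
  interpret prob_space "P x" by (rule prob_space_P)
  have m: "(\<lambda>\<omega>. f (X 0 \<omega>)) \<in> borel_measurable (P x)"
    by (rule continuous_comp_X[OF assms]) simp
  have "AE \<omega> in P x. f (X 0 \<omega>) = f x"
    using start[of x] by eventually_elim simp
  then have "(\<integral>\<omega>. f (X 0 \<omega>) \<partial>P x) = (\<integral>\<omega>. f x \<partial>P x)"
    using m by (intro integral_cong_AE) auto
  then show ?thesis
    by (simp add: payoff_eq prob_space zero_enat_def[symmetric])
qed

text \<open>After conditioning, the integrands compare pointwise. They agree for
  \<open>\<tau> < n\<close>; the bound of \<open>h\<close> by \<open>exp G\<close> settles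
  \<open>\<tau> = n\<close>, and the bound by the continuation value settles
  \<open>\<tau> > n\<close>.\<close>

lemma payoff_step_le:
  assumes \<tau>: "discrete_stopping x \<tau>"
    and f: "continuous_on UNIV f" "bounded (range f)"
    and h: "continuous_on UNIV h" "bounded (range h)"
    and le: "\<And>y. h y \<le> exp (G y)" "\<And>y. h y \<le> exp (g y) * transition P X 1 f y"
  shows "(\<integral>\<omega>. payoff \<tau> n h \<omega> \<partial>P x) \<le> (\<integral>\<omega>. payoff \<tau> (Suc n) f \<omega> \<partial>P x)"
  unfolding integral_payoff_Suc[OF \<tau> f]
proof (intro integral_mono integrable_payoff[OF \<tau> h] Bochner_Integration.integrable_add
    integrable_stopped_sum[OF \<tau>]
    integrable_disc[OF discrete_stopping_P(2)[OF \<tau>, of n] exp_g_transition_cont[OF f] exp_g_transition_bounded[OF f]])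
  fix \<omega>
  have "disc n \<omega> * h (X (of_nat n) \<omega>) \<le> disc n \<omega> * exp (G (X (of_nat n) \<omega>))"
    and "disc n \<omega> * h (X (of_nat n) \<omega>)
      \<le> disc n \<omega> * (exp (g (X (of_nat n) \<omega>)) * transition P X 1 f (X (of_nat n) \<omega>))"
    using le disc_nonneg by (auto intro!: mult_left_mono)
  then show "payoff \<tau> n h \<omega> \<le> (\<Sum>i<Suc n. of_bool (\<tau> \<omega> = enat i) * cost X g G i \<omega>)
      + of_bool (enat n < \<tau> \<omega>)
        * (disc n \<omega> * (exp (g (X (of_nat n) \<omega>)) * transition P X 1 f (X (of_nat n) \<omega>)))"
    by (cases "\<tau> \<omega>" "enat n" rule: linorder_cases) (auto simp: payoff_def cost_eq_disc)
qed

text \<open>At time \<open>k\<close> the remaining horizon is \<open>n - k\<close>. By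
  \<open>iter_Suc\<close>, \<open>iter (n - k)\<close> lies below the continuation value of
  \<open>iter (n - Suc k)\<close>, which is what \<open>payoff_step_le\<close> requires.\<close>

lemma iter_le_payoff_aux:
  assumes \<tau>: "discrete_stopping x \<tau>" and "k \<le> n"
  shows "iter n x \<le> (\<integral>\<omega>. payoff \<tau> k (iter (n - k)) \<omega> \<partial>P x)"
  using assms(2)
proof (induction k)
  case 0
  then show ?case
    by (simp add: integral_payoff_0 iter_cont)
next
  case (Suc k)
  have "iter (n - k) y \<le> exp (g y) * transition P X 1 (iter (n - Suc k)) y" for y
    using iter_Suc[of "n - Suc k" y] Suc.prems by (simp add: bellman_def Suc_diff_Suc)
  then have "(\<integral>\<omega>. payoff \<tau> k (iter (n - k)) \<omega> \<partial>P x)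
      \<le> (\<integral>\<omega>. payoff \<tau> (Suc k) (iter (n - Suc k)) \<omega> \<partial>P x)"
    by (intro payoff_step_le \<tau> iter_cont iter_bounded iter_le)
  then show ?case
    using Suc by simp
qed

lemma iter_le_payoff:
  assumes "discrete_stopping x \<tau>"
  shows "iter n x \<le> (\<integral>\<omega>. payoff \<tau> n (\<lambda>_. 1) \<omega> \<partial>P x)"
  using iter_le_payoff_aux[OF assms le_refl, of n] by (simp add: iter_def)

text \<open>\<open>Z\<close> is left general to serve both \<open>cost\<close> and
  \<open>lower_cost\<close>. Every truncation level \<open>m \<ge> n\<close> satisfies the bound, so
  the lower limit does.\<close>

lemma iter_le_stopped_expectation:
  assumes \<tau>: "discrete_stopping x \<tau>"
    and le: "\<And>m \<omega>. n \<le> m \<Longrightarrow> \<omega> \<in> space (P x) \<Longrightarrow>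
      payoff \<tau> n (\<lambda>_. 1) \<omega> \<le> Z (the_enat (min (\<tau> \<omega>) (enat m))) \<omega>"
  shows "ennreal (iter n x) \<le> stopped_expectation (P x) Z \<tau>"
  unfolding stopped_expectation_def
proof (intro Liminf_bounded eventually_sequentiallyI)
  fix m assume m: "n \<le> m"
  have nonneg: "0 \<le> payoff \<tau> n (\<lambda>_. 1) \<omega>" for \<omega>
    by (simp add: payoff_eq cost_def disc_nonneg)
  have "ennreal (iter n x) \<le> ennreal (\<integral>\<omega>. payoff \<tau> n (\<lambda>_. 1) \<omega> \<partial>P x)"
    by (intro ennreal_leI iter_le_payoff \<tau>)
  also have "\<dots> = (\<integral>\<^sup>+\<omega>. ennreal (payoff \<tau> n (\<lambda>_. 1) \<omega>) \<partial>P x)"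
    using nonneg by (intro nn_integral_eq_integral[symmetric] integrable_payoff \<tau>) auto
  also have "\<dots> \<le> (\<integral>\<^sup>+\<omega>. ennreal (Z (the_enat (min (\<tau> \<omega>) (enat m))) \<omega>) \<partial>P x)"
    by (intro nn_integral_mono ennreal_leI le m)
  finally show "ennreal (iter n x) \<le> (\<integral>\<^sup>+\<omega>. ennreal (Z (the_enat (min (\<tau> \<omega>) (enat m))) \<omega>) \<partial>P x)" .
qed

lemma disc_le_cost: "n \<le> k \<Longrightarrow> disc n \<omega> \<le> cost X g G k \<omega>"
  using sum_mono2[of "{..<k}" "{..<n}" "\<lambda>i. g (X (of_nat i) \<omega>)"] G_ge[of "X (of_nat k) \<omega>"]
  by (auto simp: disc_def cost_def g_nonneg)

text \<open>For \<open>\<tau> < n\<close> truncation at \<open>m \<ge> n\<close> changes nothing.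
  Otherwise the payoff is \<open>disc n\<close>, and the truncated time is at least
  \<open>n\<close>, so \<open>disc_le_cost\<close> applies.\<close>

lemma iter_le_stop_value: "ennreal (iter n x) \<le> stop_value P F X g G x"
  unfolding stop_value_def
proof (intro INF_greatest iter_le_stopped_expectation)
  fix \<tau> assume "\<tau> \<in> finite_stopping_times P F x"
  then show "discrete_stopping x \<tau>"
    by (simp add: finite_stopping_times_def discrete_stopping_def)
  fix m \<omega> assume "n \<le> m"
  then show "payoff \<tau> n (\<lambda>_. 1) \<omega> \<le> cost X g G (the_enat (min (\<tau> \<omega>) (enat m))) \<omega>"
    by (cases "\<tau> \<omega>") (auto simp: payoff_eq disc_le_cost)
qed

text \<open>For \<open>\<tau> \<le> n\<close> payoff and cost coincide: at \<open>\<tau> = n\<close>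
  the terminal value 1 reflects that \<open>lower_cost\<close> charges no \<open>G\<close>
  there.\<close>

lemma iter_le_lower_value_n: "ennreal (iter n x) \<le> lower_value_n P F X g G n x"
  unfolding lower_value_n_def
proof (intro INF_greatest iter_le_stopped_expectation)
  fix \<tau> assume \<tau>: "\<tau> \<in> {\<tau> \<in> finite_stopping_times P F x. \<forall>\<omega>\<in>space (P x). \<tau> \<omega> \<le> enat n}"
  then show "discrete_stopping x \<tau>"
    by (simp add: finite_stopping_times_def discrete_stopping_def)
  fix m \<omega> assume m: "n \<le> m" and \<omega>: "\<omega> \<in> space (P x)"
  then have "\<tau> \<omega> \<le> enat n"
    using \<tau> by simp
  then obtain j where j: "\<tau> \<omega> = enat j" "j \<le> n"
    by (cases "\<tau> \<omega>") auto
  then show "payoff \<tau> n (\<lambda>_. 1) \<omega> \<le> lower_cost X g G n (the_enat (min (\<tau> \<omega>) (enat m))) \<omega>"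
    using m by (cases "j < n") (auto simp: payoff_eq lower_cost_def cost_def disc_def)
qed

section \<open>The optimal stopping time\<close>

text \<open>\<open>tau_hat\<close> with \<open>w\<close> in place of the value function; the two
  times agree once \<open>stop_value_eq\<close> is available.\<close>

definition hit :: "'w \<Rightarrow> enat" where
  "hit \<omega> = Inf {enat i | i. w (X (of_nat i) \<omega>) = exp (G (X (of_nat i) \<omega>))}"

lemma discrete_stopping_hit: "discrete_stopping x hit"
proof -
  \<comment> \<open>At index \<open>\<infinity>\<close> this predicate is false, so only finite
    times need a measurability argument.\<close>
  let ?P = "\<lambda>i \<omega>. \<exists>k. i = enat k \<and> w (X (of_nat k) \<omega>) = exp (G (X (of_nat k) \<omega>))"
  have "Measurable.pred (F x (ennreal_of_enat i)) (?P i)" for i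
  proof (cases i)
    case (enat k)
    have "(\<lambda>\<omega>. w (X (of_nat k) \<omega>)) \<in> borel_measurable (F x (of_nat k))"
      "(\<lambda>\<omega>. exp (G (X (of_nat k) \<omega>))) \<in> borel_measurable (F x (of_nat k))"
      by (intro continuous_comp_X_F w_cont exp_G_cont le_refl)+
    then have "Measurable.pred (F x (of_nat k)) (\<lambda>\<omega>. w (X (of_nat k) \<omega>) = exp (G (X (of_nat k) \<omega>)))"
      by measurable
    then show ?thesis
      using enat by simp
  qed simp
  then have "stopping_time (\<lambda>i. F x (ennreal_of_enat i)) (\<lambda>\<omega>. Inf {i. ?P i \<omega>})"
    by (rule stopping_time_Inf_enat[OF filtration_enat])
  then show ?thesis
    by (simp add: discrete_stopping_def hit_def[abs_def])
qed

text \<open>A finite infimum in \<open>enat\<close> is attained: the empty set has infimum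
  \<open>\<infinity>\<close>, and a nonempty set has a least element.\<close>

lemma hit_eq_D:
  assumes "hit \<omega> = enat n"
  shows "w (X (of_nat n) \<omega>) = exp (G (X (of_nat n) \<omega>))"
proof -
  let ?A = "{enat i | i. w (X (of_nat i) \<omega>) = exp (G (X (of_nat i) \<omega>))}"
  have "?A \<noteq> {}"
    using assms unfolding hit_def by (metis Inf_enat_def enat.distinct(2) infinity_enat_def)
  then have "Inf ?A \<in> ?A"
    by (metis (no_types, lifting) Inf_enat_def LeastI ex_in_conv)
  then show ?thesis
    using assms unfolding hit_def by auto
qed

text \<open>Before \<open>hit\<close> the stopping branch differs from \<open>w\<close>, so the
  minimum in the fixed point equation is the continuation value.\<close>

lemma hit_gt_D:
  assumes "enat n < hit \<omega>"
  shows "exp (g (X (of_nat n) \<omega>)) * transition P X 1 w (X (of_nat n) \<omega>) = w (X (of_nat n) \<omega>)"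
proof -
  have "w (X (of_nat n) \<omega>) \<noteq> exp (G (X (of_nat n) \<omega>))"
  proof
    assume "w (X (of_nat n) \<omega>) = exp (G (X (of_nat n) \<omega>))"
    then have "hit \<omega> \<le> enat n"
      unfolding hit_def by (intro Inf_lower) auto
    then show False
      using assms by simp
  qed
  then show ?thesis
    using w_fixed_point[of "X (of_nat n) \<omega>"] by (auto simp: bellman_def min_def split: if_splits)
qed

text \<open>Along \<open>hit\<close> both inequalities behind \<open>payoff_step_le\<close> become
  equalities for \<open>w\<close>: \<open>w\<close> equals \<open>exp G\<close> at
  \<open>hit\<close> and the continuation value before. This is the martingale property of the
  stopped value process.\<close>

lemma integral_payoff_hit_w: "(\<integral>\<omega>. payoff hit n w \<omega> \<partial>P x) = w x"
proof (induction n)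
  case 0
  show ?case
    by (rule integral_payoff_0[OF w_cont])
next
  case (Suc n)
  have "payoff hit n w \<omega> = (\<Sum>i<Suc n. of_bool (hit \<omega> = enat i) * cost X g G i \<omega>)
      + of_bool (enat n < hit \<omega>)
        * (disc n \<omega> * (exp (g (X (of_nat n) \<omega>)) * transition P X 1 w (X (of_nat n) \<omega>)))" for \<omega>
    by (cases "hit \<omega>" "enat n" rule: linorder_cases)
      (auto simp: payoff_def cost_eq_disc hit_eq_D hit_gt_D)
  then show ?case
    using Suc unfolding integral_payoff_Suc[OF discrete_stopping_hit w_cont w_bounded] by simp
qed

section \<open>Geometric decay of the unstopped contribution\<close>

definition tail :: "'e \<Rightarrow> nat \<Rightarrow> real" where
  "tail x n = (\<integral>\<omega>. of_bool (enat n < hit \<omega>) * (disc n \<omega> * (w (X (of_nat n) \<omega>) - a)) \<partial>P x)"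

lemma w_a_cont: "continuous_on UNIV (\<lambda>y. w y - a)"
  by (intro continuous_intros w_cont)

lemma w_a_nonneg: "0 \<le> w y - a"
  using w_ge[of y] a_less_1 by simp

lemma w_a_bounded: "bounded (range (\<lambda>y. w y - a))"
proof (rule bounded_rangeI[OF w_a_nonneg])
  show "w y - a \<le> exp b" for y
    using w_le_bound[of y] a_pos by linarith
qed

lemma integrable_tail:
  "integrable (P x) (\<lambda>\<omega>. of_bool (enat n < hit \<omega>) * (disc n \<omega> * (w (X (of_nat n) \<omega>) - a)))"
  by (intro integrable_disc discrete_stopping_P(2)[OF discrete_stopping_hit] w_a_cont w_a_bounded)

text \<open>With \<open>w\<close> alone as weight, the continuation step before \<open>hit\<close>
  would merely preserve the value. Subtracting \<open>a\<close> loses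
  \<open>exp g * a \<ge> 1\<close> in each step, which makes the weight contract by
  \<open>\<kappa>\<close>.\<close>

lemma tail_Suc: "tail x (Suc n) \<le> \<kappa> * tail x n"
proof -
  have trans: "transition P X 1 (\<lambda>y. w y - a) y = transition P X 1 w y - a" for y
    using transition_affine[OF w_cont w_bounded, of 1 "- a" y] by simp
  have int: "integrable (P x) (\<lambda>\<omega>. of_bool (enat n < hit \<omega>)
      * (disc (Suc n) \<omega> * (w (X (of_nat (Suc n)) \<omega>) - a)))"
    by (intro integrable_disc discrete_stopping_P(2)[OF discrete_stopping_hit] w_a_cont w_a_bounded)
  have int2: "integrable (P x) (\<lambda>\<omega>. of_bool (enat n < hit \<omega>)
      * (disc n \<omega> * (exp (g (X (of_nat n) \<omega>)) * transition P X 1 (\<lambda>y. w y - a) (X (of_nat n) \<omega>))))"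
    by (rule integrable_disc[OF discrete_stopping_P(2)[OF discrete_stopping_hit]
          exp_g_transition_cont[OF w_a_cont w_a_bounded] exp_g_transition_bounded[OF w_a_cont w_a_bounded]])
  \<comment> \<open>The event is enlarged to \<open>enat n < hit\<close>, which is known at time
    \<open>n\<close>, so that \<open>markov_disc\<close> applies next.\<close>
  have "tail x (Suc n) \<le> (\<integral>\<omega>. of_bool (enat n < hit \<omega>)
      * (disc (Suc n) \<omega> * (w (X (of_nat (Suc n)) \<omega>) - a)) \<partial>P x)"
    unfolding tail_def
  proof (intro integral_mono integrable_tail int mult_right_mono)
    fix \<omega>
    have "enat n < hit \<omega>" if "enat (Suc n) < hit \<omega>"
      using that by (rule less_trans[rotated]) simp
    then show "(of_bool (enat (Suc n) < hit \<omega>) :: real) \<le> of_bool (enat n < hit \<omega>)"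
      by (auto simp: of_bool_def)
    show "0 \<le> disc (Suc n) \<omega> * (w (X (of_nat (Suc n)) \<omega>) - a)"
      by (intro mult_nonneg_nonneg disc_nonneg w_a_nonneg)
  qed
  also have "\<dots> = (\<integral>\<omega>. of_bool (enat n < hit \<omega>) * (disc n \<omega> * (exp (g (X (of_nat n) \<omega>))
      * transition P X 1 (\<lambda>y. w y - a) (X (of_nat n) \<omega>))) \<partial>P x)"
    by (rule markov_disc[OF discrete_stopping_hit w_a_cont w_a_bounded])
  also have "\<dots> \<le> (\<integral>\<omega>. \<kappa> * (of_bool (enat n < hit \<omega>) * (disc n \<omega> * (w (X (of_nat n) \<omega>) - a))) \<partial>P x)"
  proof (intro integral_mono int2 integrable_mult_right integrable_tail)
    fix \<omega>
    let ?y = "X (of_nat n) \<omega>"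
    show "of_bool (enat n < hit \<omega>) * (disc n \<omega> * (exp (g ?y) * transition P X 1 (\<lambda>y. w y - a) ?y))
      \<le> \<kappa> * (of_bool (enat n < hit \<omega>) * (disc n \<omega> * (w ?y - a)))"
    proof (cases "enat n < hit \<omega>")
      case True
      have "exp (g ?y) * transition P X 1 (\<lambda>y. w y - a) ?y = w ?y - exp (g ?y) * a"
        using hit_gt_D[OF True] by (simp add: trans right_diff_distrib)
      also have "\<dots> \<le> \<kappa> * (w ?y - a)"
        using \<kappa>_bound[OF w_le_bound[of ?y]] exp_g_a[of ?y] by linarith
      finally have "disc n \<omega> * (exp (g ?y) * transition P X 1 (\<lambda>y. w y - a) ?y)
          \<le> disc n \<omega> * (\<kappa> * (w ?y - a))"
        by (rule mult_left_mono[OF _ disc_nonneg])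
      then show ?thesis
        using True by (simp add: ac_simps)
    qed simp
  qed
  finally show ?thesis
    by (simp add: tail_def)
qed

lemma tail_tendsto: "tail x \<longlonglongrightarrow> 0"
proof (rule tendsto_sandwich[OF _ _ tendsto_const])
  have "tail x n \<le> \<kappa> ^ n * tail x 0" for n
  proof (induction n)
    case (Suc n)
    then show ?case
      using tail_Suc[of x n] mult_left_mono[OF Suc \<kappa>_nonneg] by (simp add: mult.assoc)
  qed simp
  then show "\<forall>\<^sub>F n in sequentially. tail x n \<le> \<kappa> ^ n * tail x 0"
    by simp
  show "(\<lambda>n. \<kappa> ^ n * tail x 0) \<longlonglongrightarrow> 0"
    by (rule tendsto_mult_left_zero[OF \<kappa>_power_tendsto])
  show "\<forall>\<^sub>F n in sequentially. 0 \<le> tail x n"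
    unfolding tail_def
    by (intro always_eventually allI integral_nonneg_AE AE_I2 mult_nonneg_nonneg disc_nonneg w_a_nonneg) simp
qed

text \<open>Where \<open>hit\<close> is infinite, the integrand of every \<open>tail x n\<close> is
  at least \<open>1 - a > 0\<close>, because \<open>disc\<close> and \<open>w\<close> are at least
  1. Vanishing of the tails leaves no mass there.\<close>

lemma hit_finite: "AE \<omega> in P x. hit \<omega> < \<infinity>"
proof -
  interpret prob_space "P x" by (rule prob_space_P)
  have "hit \<omega> = \<infinity> \<longleftrightarrow> (\<forall>n. enat n < hit \<omega>)" for \<omega>
    by (cases "hit \<omega>") auto
  then have pred: "Measurable.pred (P x) (\<lambda>\<omega>. hit \<omega> = \<infinity>)"
    using discrete_stopping_P(2)[OF discrete_stopping_hit] by (simp add: pred_intros_countable)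
  have int: "integrable (P x) (\<lambda>\<omega>. of_bool (hit \<omega> = \<infinity>) * (1 - a))"
    using integrable_disc[OF pred, of "\<lambda>_. 1 - a" 0] by simp
  have "(\<integral>\<omega>. of_bool (hit \<omega> = \<infinity>) * (1 - a) \<partial>P x) \<le> tail x n" for n
    unfolding tail_def
  proof (intro integral_mono int integrable_tail)
    fix \<omega>
    have "1 * (1 - a) \<le> disc n \<omega> * (w (X (of_nat n) \<omega>) - a)"
      using disc_ge w_ge a_less_1 disc_nonneg by (intro mult_mono) auto
    moreover have "0 \<le> disc n \<omega> * (w (X (of_nat n) \<omega>) - a)"
      by (intro mult_nonneg_nonneg disc_nonneg w_a_nonneg)
    ultimately show "of_bool (hit \<omega> = \<infinity>) * (1 - a)
        \<le> of_bool (enat n < hit \<omega>) * (disc n \<omega> * (w (X (of_nat n) \<omega>) - a))"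
      by (cases "hit \<omega>") auto
  qed
  then have "(\<integral>\<omega>. of_bool (hit \<omega> = \<infinity>) * (1 - a) \<partial>P x) \<le> 0"
    by (intro LIMSEQ_le_const[OF tail_tendsto]) auto
  moreover have "0 \<le> (\<integral>\<omega>. of_bool (hit \<omega> = \<infinity>) * (1 - a) \<partial>P x)"
    using a_less_1 by (intro integral_nonneg_AE AE_I2) auto
  ultimately have "(\<integral>\<omega>. of_bool (hit \<omega> = \<infinity>) * (1 - a) \<partial>P x) = 0"
    by linarith
  then have "AE \<omega> in P x. of_bool (hit \<omega> = \<infinity>) * (1 - a) = 0"
    using a_less_1 by (subst (asm) integral_nonneg_eq_0_iff_AE[OF int]) auto
  then show ?thesis
  proof eventually_elim
    case (elim \<omega>)
    then show ?case
      using a_less_1 by (cases "hit \<omega>") auto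
  qed
qed

text \<open>Changing the terminal value from \<open>w\<close> to \<open>exp G\<close> affects the
  payoff only on \<open>enat n < hit\<close>, and the change there is dominated by a multiple of the
  tail.\<close>

lemma integral_payoff_hit_tendsto: "(\<lambda>n. \<integral>\<omega>. payoff hit n (\<lambda>y. exp (G y)) \<omega> \<partial>P x) \<longlonglongrightarrow> w x"
proof (rule tendsto_sandwich[OF _ _ tendsto_const])
  note int = integrable_payoff[OF discrete_stopping_hit w_cont w_bounded]
    integrable_payoff[OF discrete_stopping_hit exp_G_cont exp_G_bounded]
  have "w x \<le> (\<integral>\<omega>. payoff hit n (\<lambda>y. exp (G y)) \<omega> \<partial>P x)" for n
    unfolding integral_payoff_hit_w[of x n, symmetric]
    by (intro integral_mono int) (auto simp: payoff_eq intro!: mult_left_mono disc_nonneg w_le)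
  then show "\<forall>\<^sub>F n in sequentially. w x \<le> (\<integral>\<omega>. payoff hit n (\<lambda>y. exp (G y)) \<omega> \<partial>P x)"
    by simp
  \<comment> \<open>This factor gives
    \<open>exp (G y) \<le> exp b = r * (1 - a) \<le> r * (w y - a)\<close>.\<close>
  define r where "r = exp b / (1 - a)"
  have r: "0 \<le> r" "r * (1 - a) = exp b"
    using a_less_1 by (auto simp: r_def)
  have "(\<integral>\<omega>. payoff hit n (\<lambda>y. exp (G y)) \<omega> \<partial>P x) \<le> w x + r * tail x n" for n
  proof -
    have "(\<integral>\<omega>. payoff hit n (\<lambda>y. exp (G y)) \<omega> \<partial>P x)
        \<le> (\<integral>\<omega>. payoff hit n w \<omega>
          + r * (of_bool (enat n < hit \<omega>) * (disc n \<omega> * (w (X (of_nat n) \<omega>) - a))) \<partial>P x)"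
    proof (intro integral_mono int Bochner_Integration.integrable_add integrable_mult_right integrable_tail)
      fix \<omega>
      let ?y = "X (of_nat n) \<omega>"
      show "payoff hit n (\<lambda>y. exp (G y)) \<omega>
        \<le> payoff hit n w \<omega> + r * (of_bool (enat n < hit \<omega>) * (disc n \<omega> * (w ?y - a)))"
      proof (cases "hit \<omega>" "enat n" rule: linorder_cases)
        case greater
        have "r * (1 - a) \<le> r * (w ?y - a)"
          using w_ge[of ?y] r by (intro mult_left_mono) auto
        then have "exp (G ?y) \<le> w ?y + r * (w ?y - a)"
          using exp_G_le[of ?y] w_ge[of ?y] r by linarith
        then have "disc n \<omega> * exp (G ?y) \<le> disc n \<omega> * (w ?y + r * (w ?y - a))"
          by (rule mult_left_mono[OF _ disc_nonneg])
        then show ?thesis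
          using greater by (auto simp: payoff_eq distrib_left mult.left_commute)
      qed (simp_all add: payoff_eq hit_eq_D)
    qed
    also have "\<dots> = w x + r * tail x n"
      using int(1)[of x n] integrable_tail[of x n] by (simp add: integral_payoff_hit_w tail_def)
    finally show ?thesis .
  qed
  then show "\<forall>\<^sub>F n in sequentially.
      (\<integral>\<omega>. payoff hit n (\<lambda>y. exp (G y)) \<omega> \<partial>P x) \<le> w x + r * tail x n"
    by simp
  have "(\<lambda>n. w x + r * tail x n) \<longlonglongrightarrow> w x + r * 0"
    by (intro tendsto_intros tail_tendsto)
  then show "(\<lambda>n. w x + r * tail x n) \<longlonglongrightarrow> w x"
    by simp
qed

section \<open>Identification of the value functions\<close>

lemma payoff_exp_G: "payoff \<tau> n (\<lambda>y. exp (G y)) \<omega> = cost X g G (the_enat (min (\<tau> \<omega>) (enat n))) \<omega>"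
  by (cases "\<tau> \<omega>") (auto simp: payoff_eq cost_eq_disc min_def)

text \<open>With terminal value \<open>exp G\<close>, the finite-horizon payoffs are exactly the
  truncated costs inside \<open>stopped_expectation\<close>.\<close>

lemma nn_integral_cost_min:
  assumes "discrete_stopping x \<tau>"
  shows "(\<integral>\<^sup>+\<omega>. ennreal (cost X g G (the_enat (min (\<tau> \<omega>) (enat n))) \<omega>) \<partial>P x)
    = ennreal (\<integral>\<omega>. payoff \<tau> n (\<lambda>y. exp (G y)) \<omega> \<partial>P x)"
  unfolding payoff_exp_G[symmetric]
  by (intro nn_integral_eq_integral integrable_payoff assms exp_G_cont exp_G_bounded AE_I2)
    (simp add: payoff_exp_G cost_def)

lemma hit_in_finite_stopping_times: "hit \<in> finite_stopping_times P F x"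
  using discrete_stopping_hit hit_finite by (simp add: finite_stopping_times_def discrete_stopping_def)

lemma stopped_expectation_hit: "stopped_expectation (P x) (cost X g G) hit = ennreal (w x)"
  unfolding stopped_expectation_def nn_integral_cost_min[OF discrete_stopping_hit]
  by (intro lim_imp_Liminf tendsto_ennrealI integral_payoff_hit_tendsto) simp

text \<open>The truncation of \<open>hit\<close> at \<open>n\<close> is admissible for the horizon
  \<open>n\<close>.\<close>

lemma upper_value_n_le:
  "upper_value_n P F X g G n x \<le> ennreal (\<integral>\<omega>. payoff hit n (\<lambda>y. exp (G y)) \<omega> \<partial>P x)"
proof -
  let ?\<sigma> = "\<lambda>\<omega>. min (hit \<omega>) (enat n)"
  have "?\<sigma> \<in> {\<tau> \<in> finite_stopping_times P F x. \<forall>\<omega>\<in>space (P x). \<tau> \<omega> \<le> enat n}"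
    using stopping_time_min[OF discrete_stopping_hit[of x, unfolded discrete_stopping_def]
        stopping_time_const[of _ "enat n"]] hit_finite[of x]
    by (auto simp: finite_stopping_times_def min_less_iff_disj simp del: not_infinity_eq)
  then have "upper_value_n P F X g G n x \<le> stopped_expectation (P x) (cost X g G) ?\<sigma>"
    unfolding upper_value_n_def by (rule INF_lower)
  also have "\<dots> = ennreal (\<integral>\<omega>. payoff hit n (\<lambda>y. exp (G y)) \<omega> \<partial>P x)"
    unfolding stopped_expectation_def
  \<comment> \<open>A second truncation at \<open>m \<ge> n\<close> has no effect, so the sequence
    under the lower limit is eventually constant.\<close>
  proof (intro lim_imp_Liminf tendsto_eventually eventually_sequentiallyI[of n])
    fix m assume "n \<le> m"
    then have "min (min (hit \<omega>) (enat n)) (enat m) = min (hit \<omega>) (enat n)" for \<omega>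
      by (simp add: min.assoc)
    then show "(\<integral>\<^sup>+\<omega>. ennreal (cost X g G (the_enat (min (min (hit \<omega>) (enat n)) (enat m))) \<omega>) \<partial>P x)
        = ennreal (\<integral>\<omega>. payoff hit n (\<lambda>y. exp (G y)) \<omega> \<partial>P x)"
      by (simp add: nn_integral_cost_min[OF discrete_stopping_hit])
  qed simp
  finally show ?thesis .
qed

lemma ennreal_w_le:
  assumes "\<And>n. ennreal (iter n x) \<le> r"
  shows "ennreal (w x) \<le> r"
  by (rule LIMSEQ_le_const2[OF tendsto_ennrealI[OF iter_tendsto_w]]) (use assms in auto)

lemma stop_value_eq: "stop_value P F X g G x = ennreal (w x)"
proof (rule antisym)
  show "stop_value P F X g G x \<le> ennreal (w x)"
    unfolding stop_value_def stopped_expectation_hit[symmetric]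
    by (rule INF_lower[OF hit_in_finite_stopping_times])
  show "ennreal (w x) \<le> stop_value P F X g G x"
    by (rule ennreal_w_le[OF iter_le_stop_value])
qed

lemma lower_value_n_le_upper_value_n: "lower_value_n P F X g G n x \<le> upper_value_n P F X g G n x"
  unfolding lower_value_n_def upper_value_n_def stopped_expectation_def
  by (intro INF_mono' Liminf_mono always_eventually allI nn_integral_mono ennreal_leI)
    (simp add: lower_cost_def cost_def G_ge)

text \<open>The limits are squeezed: the iterates bound the lower values from below, the lower
  values lie below the upper ones, and truncated \<open>hit\<close> bounds the upper values from
  above. Both outer bounds tend to \<open>w\<close>.\<close>

lemma lower_upper_value_eq:
  "lower_value P F X g G x = ennreal (w x)" "upper_value P F X g G x = ennreal (w x)"
proof -
  note lower = lower_value_n_tendsto[of g G P F X x, OF g_nonneg G_ge]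
  note upper = upper_value_n_tendsto[of P F X g G x]
  have 1: "ennreal (w x) \<le> lower_value P F X g G x"
    using LIMSEQ_le[OF tendsto_ennrealI[OF iter_tendsto_w] lower] iter_le_lower_value_n by blast
  have 2: "lower_value P F X g G x \<le> upper_value P F X g G x"
    using LIMSEQ_le[OF lower upper] lower_value_n_le_upper_value_n by blast
  have 3: "upper_value P F X g G x \<le> ennreal (w x)"
    using LIMSEQ_le[OF upper tendsto_ennrealI[OF integral_payoff_hit_tendsto]] upper_value_n_le by blast
  show "lower_value P F X g G x = ennreal (w x)" "upper_value P F X g G x = ennreal (w x)"
    using 1 2 3 by auto
qed

lemma tau_hat_eq_hit: "tau_hat P F X g G = hit"
proof
  fix \<omega>
  have "ennreal (w y) = ennreal (exp (G y)) \<longleftrightarrow> w y = exp (G y)" for y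
    using w_ge[of y] by (intro ennreal_inj) auto
  then show "tau_hat P F X g G \<omega> = hit \<omega>"
    by (simp add: tau_hat_def hit_def stop_value_eq)
qed

end

theorem theorem3p5:
  fixes \<Omega> :: "'w set"
    and P :: "'e::metric_space \<Rightarrow> 'w measure"
    and F :: "'e \<Rightarrow> ennreal \<Rightarrow> 'w measure"
    and X :: "ennreal \<Rightarrow> 'w \<Rightarrow> 'e"
    and g G :: "'e \<Rightarrow> real"
    and c :: real
  assumes "locally_compact_space (euclidean :: 'e topology)"
    and "separable_space (euclidean :: 'e topology)"
    and "standard_markov_process \<Omega> P F X"
    and "C0_Feller P X"
    and "continuous_on UNIV g" and "bounded (range g)" and "\<And>x. 0 \<le> g x"
    and "continuous_on UNIV G" and "bounded (range G)" and "\<And>x. 0 \<le> G x"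
    and "0 < c" and "\<And>x. c \<le> g x"
  shows "continuous_on UNIV (stop_value P F X g G)
    \<and> (\<exists>C::real. \<forall>x. stop_value P F X g G x \<le> ennreal C)
    \<and> (\<forall>x. lower_value P F X g G x = stop_value P F X g G x \<and> stop_value P F X g G x = upper_value P F X g G x)
    \<and> (\<forall>x. tau_hat P F X g G \<in> finite_stopping_times P F x
         \<and> stopped_expectation (P x) (cost X g G) (tau_hat P F X g G) = stop_value P F X g G x)"
proof -
  obtain d where d: "\<And>x. \<bar>g x\<bar> \<le> d"
    using assms(6) by (auto simp: bounded_iff)
  obtain b where b: "\<And>x. \<bar>G x\<bar> \<le> b"
    using assms(9) by (auto simp: bounded_iff)
  \<comment> \<open>The extension beyond \<open>C0\<close> matters because the constant 1 that
    starts the iteration need not vanish at infinity.\<close>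
  have Feller: "continuous_on UNIV (transition P X 1 f)"
    if "continuous_on UNIV f" "bounded (range f)" for f
    using standard_markov_process.transition_continuous[OF assms(3,1,2,4) _ that] by simp
  interpret exponential_stopping \<Omega> P F X g G b c d
    using assms(3)
  proof (rule exponential_stopping.intro)
    show "exponential_stopping_axioms P X g G b c d"
      using assms Feller abs_le_D1[OF d] abs_le_D1[OF b] by unfold_locales
  qed
  have "stop_value P F X g G = (\<lambda>x. ennreal (w x))"
    by (rule ext) (rule stop_value_eq)
  then have "continuous_on UNIV (stop_value P F X g G)"
    using w_cont by (simp add: continuous_on_ennreal)
  moreover have "stop_value P F X g G x \<le> ennreal (exp b)" for x
    unfolding stop_value_eq by (rule ennreal_leI[OF w_le_bound])
  then have "\<exists>C. \<forall>x. stop_value P F X g G x \<le> ennreal C"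
    by blast
  ultimately show ?thesis
    using lower_upper_value_eq stopped_expectation_hit hit_in_finite_stopping_times
    by (auto simp: stop_value_eq tau_hat_eq_hit)
qed

end
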